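(* Let $N\ge2$. The parafermion planar para algebra $PF_\bullet$ is half-braided. Explicitly, the zero-graded $2$-boxes $b_+$, $b_-$ in $PF_2$ defined by $$b_-=\frac{\omega^{1/2}}{\sqrt N}\sum_{i=0}^{N-1}c_1^{\,i}c_2^{-i},\qquad b_+=\frac{\omega^{-1/2}}{\sqrt N}\sum_{i=0}^{N-1}c_2^{-i}c_1^{\,i}$$ satisfy: (a) $\mathfrak{F}_{\mathrm{s}}(b_+)=b_-$ and $\mathfrak{F}_{\mathrm{s}}(b_-)=b_+$; (b) $b_+b_-=1$ (Reidemeister move of type II); (c) any $m$-box can move under the string: for every $m\ge1$ and every $x\in PF_m$, $$\sigma(x)\,b_{+,1}b_{+,2}\cdots b_{+,m}=b_{+,1}b_{+,2}\cdots b_{+,m}\,x\quad\text{in }PF_{m+1}.$$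
   Context: Let $q=e^{2\pi i/N}$, $\zeta$ a square root of $q$ with $\zeta^{N^2}=1$, $\omega=\frac1{\sqrt N}\sum_{i=0}^{N-1}\zeta^{i^2}$ (which satisfies $|\omega|=1$), and $\omega^{1/2}$ a fixed square root of $\omega$, with $\omega^{-1/2}$ its inverse. $PF_m$ is the complex algebra generated by $c_1,\dots,c_m$ with $c_i^N=1$ and $c_ic_j=q\,c_jc_i$ for $i<j$; it has basis $c_1^{i_1}\cdots c_m^{i_m}$, $0\le i_k\le N-1$, is $\mathbb{Z}_N$-graded with each $c_i$ of grading $1$, and has trace $\mathrm{tr}(1)=1$, $\mathrm{tr}=0$ on the other basis elements. $PF_m\subset PF_{m+1}$ naturally, and $\sigma:PF_m\to PF_{m+1}$ is $c_i\mapsto c_{i+1}$. $PF_m$ is the $m$-box space of the parafermion planar para algebra: $c_i$ is $m$ vertical strings with the $i$-th labelled by $c$, and $xy$ is drawn with $y$ stacked on top of $x$. $b_{+,i}\in PF_{m+1}$ denotes $b_+$ placed on strings $i,i+1$, i.e. with $c_1,c_2$ replaced by $c_i,c_{i+1}$; $b_\pm$ are drawn as the two crossings of two strings, and the product $b_{+,1}\cdots b_{+,m}$ is one string crossing over $m$ strings. With $E_i=\frac1{\sqrt N}\sum_{k=0}^{N-1}\zeta^{k^2}c_i^{\,k}c_{i+1}^{-k}$ and $\Phi_r:PF_{m+1}\to PF_m$ the trace-preserving conditional expectation, the string Fourier transform on $PF_m$ (the clockwise one-string rotation) is $\mathfrak{F}_{\mathrm{s}}(x)=\sqrt N\,\Phi_r(E_mE_{m-1}\cdots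 E_1\sigma(x))$. *)

theory Defs
  imports "HOL-Analysis.Analysis"
begin

text \<open>
  Conventions. \<open>N\<close> is the cardinality of a finite type \<open>'n\<close>. Strings are numbered from 0, so
  \<open>pf_gen i\<close> is the generator usually written c with index \<open>i + 1\<close>. All box spaces live in one
  algebra, presented by generators \<open>pf_gen 0, pf_gen 1, ...\<close>; the space of \<open>m\<close>-boxes is the
  subalgebra \<open>PF m\<close> generated by the first \<open>m\<close> of them, so that the natural inclusion of
  \<open>m\<close>-boxes into \<open>(m + 1)\<close>-boxes is the inclusion of subsets.
\<close>

definition pf_q :: "nat \<Rightarrow> complex"
  where "pf_q N = exp (2 * of_real pi * \<i> / of_nat N)"

subsection \<open>The algebra by generators and relations\<close>

datatype pf_term = Const complex | Gen nat | Add pf_term pf_term | Mul pf_term pf_term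

text \<open>
  The least congruence that makes terms a unital complex algebra and imposes the parafermion
  relations \<open>gen_pow\<close> and \<open>gen_comm\<close>.
\<close>

inductive pf_eq :: "nat \<Rightarrow> pf_term \<Rightarrow> pf_term \<Rightarrow> bool" for N :: nat where
  refl: "pf_eq N x x"
| sym: "pf_eq N x y \<Longrightarrow> pf_eq N y x"
| trans: "pf_eq N x y \<Longrightarrow> pf_eq N y z \<Longrightarrow> pf_eq N x z"
| add_cong: "pf_eq N x x' \<Longrightarrow> pf_eq N y y' \<Longrightarrow> pf_eq N (Add x y) (Add x' y')"
| mul_cong: "pf_eq N x x' \<Longrightarrow> pf_eq N y y' \<Longrightarrow> pf_eq N (Mul x y) (Mul x' y')"
| add_assoc: "pf_eq N (Add (Add x y) z) (Add x (Add y z))"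
| add_comm: "pf_eq N (Add x y) (Add y x)"
| add_zero: "pf_eq N (Add (Const 0) x) x"
| add_neg: "pf_eq N (Add (Mul (Const (-1)) x) x) (Const 0)"
| mul_assoc: "pf_eq N (Mul (Mul x y) z) (Mul x (Mul y z))"
| mul_one: "pf_eq N (Mul (Const 1) x) x"
| distrib_l: "pf_eq N (Mul x (Add y z)) (Add (Mul x y) (Mul x z))"
| distrib_r: "pf_eq N (Mul (Add x y) z) (Add (Mul x z) (Mul y z))"
| const_add: "pf_eq N (Add (Const a) (Const b)) (Const (a + b))"
| const_mul: "pf_eq N (Mul (Const a) (Const b)) (Const (a * b))"
| const_central: "pf_eq N (Mul (Const a) x) (Mul x (Const a))"
| gen_pow: "pf_eq N ((Mul (Gen i) ^^ N) (Const 1)) (Const 1)"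
| gen_comm: "i < j \<Longrightarrow>
    pf_eq N (Mul (Gen i) (Gen j)) (Mul (Const (pf_q N)) (Mul (Gen j) (Gen i)))"

lemma pf_eq_equivp: "equivp (pf_eq N)"
  by (intro equivpI reflpI sympI transpI) (blast intro: pf_eq.refl pf_eq.sym pf_eq.trans)+

quotient_type 'n pf = pf_term / "pf_eq CARD('n::finite)"
  by (rule pf_eq_equivp)

lift_definition pf_const :: "complex \<Rightarrow> 'n::finite pf" is Const .
lift_definition pf_gen :: "nat \<Rightarrow> 'n::finite pf" is Gen .

instantiation pf :: (finite) "{ring, monoid_mult}"
begin

lift_definition zero_pf :: "'a pf" is "Const 0" .
lift_definition one_pf :: "'a pf" is "Const 1" .
lift_definition plus_pf :: "'a pf \<Rightarrow> 'a pf \<Rightarrow> 'a pf" is Add by (rule pf_eq.add_cong)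
lift_definition times_pf :: "'a pf \<Rightarrow> 'a pf \<Rightarrow> 'a pf" is Mul by (rule pf_eq.mul_cong)
lift_definition uminus_pf :: "'a pf \<Rightarrow> 'a pf" is "Mul (Const (-1))"
  by (intro pf_eq.mul_cong pf_eq.refl)
definition minus_pf :: "'a pf \<Rightarrow> 'a pf \<Rightarrow> 'a pf" where "minus_pf x y = x + - y"

instance
proof
  fix a b c :: "'a pf"
  show "a + b + c = a + (b + c)" by transfer (rule pf_eq.add_assoc)
  show "a + b = b + a" by transfer (rule pf_eq.add_comm)
  show "0 + a = a" by transfer (rule pf_eq.add_zero)
  show "- a + a = 0" by transfer (rule pf_eq.add_neg)
  show "a - b = a + - b" by (rule minus_pf_def)
  show "a * b * c = a * (b * c)" by transfer (rule pf_eq.mul_assoc)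
  show "(a + b) * c = a * c + b * c" by transfer (rule pf_eq.distrib_r)
  show "a * (b + c) = a * b + a * c" by transfer (rule pf_eq.distrib_l)
  show "1 * a = a" by transfer (rule pf_eq.mul_one)
  show "a * 1 = a" by transfer (blast intro: pf_eq.mul_one pf_eq.const_central pf_eq.sym pf_eq.trans)
qed

end

definition pf_scale :: "complex \<Rightarrow> 'n::finite pf \<Rightarrow> 'n pf"
  where "pf_scale a x = pf_const a * x"

lemma pf_const_0: "pf_const 0 = 0" by transfer (rule pf_eq.refl)
lemma pf_const_1: "pf_const 1 = 1" by transfer (rule pf_eq.refl)
lemma pf_const_add: "pf_const (a + b) = pf_const a + pf_const b"
  by transfer (rule pf_eq.sym, rule pf_eq.const_add)
lemma pf_const_mult: "pf_const (a * b) = pf_const a * pf_const b"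
  by transfer (rule pf_eq.sym, rule pf_eq.const_mul)
lemma pf_const_commute: "pf_const a * x = x * pf_const a"
  by transfer (rule pf_eq.const_central)

interpretation pf: vector_space pf_scale
  by standard
    (simp_all add: pf_scale_def pf_const_1 pf_const_add pf_const_mult distrib_left distrib_right
      mult.assoc)

lemma pf_scale_mult_left: "pf_scale a x * y = pf_scale a (x * y)"
  by (simp add: pf_scale_def mult.assoc)

lemma pf_scale_mult_right: "x * pf_scale a y = pf_scale a (x * y)"
  by (metis pf_scale_def pf_const_commute mult.assoc)

lemma pf_gen_power_card: "(pf_gen i :: 'n::finite pf) ^ CARD('n) = 1"
proof -
  have "abs_pf ((Mul (Gen i) ^^ k) (Const 1)) = (pf_gen i :: 'n pf) ^ k" for k
    by (induction k) (simp_all add: one_pf.abs_eq pf_gen.abs_eq flip: times_pf.abs_eq)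
  moreover have "abs_pf ((Mul (Gen i) ^^ CARD('n)) (Const 1)) = (abs_pf (Const 1) :: 'n pf)"
    by (simp add: pf.abs_eq_iff pf_eq.gen_pow)
  ultimately show ?thesis by (simp add: one_pf.abs_eq)
qed

lemma pf_gen_commute:
  "i < j \<Longrightarrow> (pf_gen i :: 'n::finite pf) * pf_gen j = pf_scale (pf_q CARD('n)) (pf_gen j * pf_gen i)"
  unfolding pf_scale_def by transfer (rule pf_eq.gen_comm)

definition pf_gen_inv :: "nat \<Rightarrow> 'n::finite pf"
  where "pf_gen_inv i = pf_gen i ^ (CARD('n) - 1)"

lemma pf_gen_inv: "pf_gen i * pf_gen_inv i = (1 :: 'n::finite pf)"
    "pf_gen_inv i * pf_gen i = (1 :: 'n::finite pf)"
proof -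
  have "CARD('n) = Suc (CARD('n) - 1)" by simp
  then show "pf_gen i * pf_gen_inv i = (1 :: 'n pf)" "pf_gen_inv i * pf_gen i = (1 :: 'n pf)"
    unfolding pf_gen_inv_def
    by (metis power_Suc power_Suc2 pf_gen_power_card)+
qed

subsection \<open>Box spaces, basis, grading, shift\<close>

inductive_set PF :: "nat \<Rightarrow> ('n::finite pf) set" for m :: nat where
  const: "pf_const a \<in> PF m"
| gen: "i < m \<Longrightarrow> pf_gen i \<in> PF m"
| add: "x \<in> PF m \<Longrightarrow> y \<in> PF m \<Longrightarrow> x + y \<in> PF m"
| mult: "x \<in> PF m \<Longrightarrow> y \<in> PF m \<Longrightarrow> x * y \<in> PF m"

definition pf_monomial :: "nat \<Rightarrow> (nat \<Rightarrow> nat) \<Rightarrow> 'n::finite pf"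
  where "pf_monomial m e = prod_list (map (\<lambda>i. pf_gen i ^ e i) [0..<m])"

definition PF_graded :: "nat \<Rightarrow> nat \<Rightarrow> ('n::finite pf) set" where
  "PF_graded m d = pf.span {pf_monomial m e | e.
     (\<forall>i<m. e i < CARD('n)) \<and> (\<Sum>i<m. e i) mod CARD('n) = d mod CARD('n)}"

primrec pf_shift_term :: "pf_term \<Rightarrow> pf_term" where
  "pf_shift_term (Const a) = Const a"
| "pf_shift_term (Gen i) = Gen (Suc i)"
| "pf_shift_term (Add x y) = Add (pf_shift_term x) (pf_shift_term y)"
| "pf_shift_term (Mul x y) = Mul (pf_shift_term x) (pf_shift_term y)"

lift_definition pf_shift :: "'n::finite pf \<Rightarrow> 'n pf" is pf_shift_term
proof -
  fix x y assume "pf_eq CARD('n) x y"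
  then show "pf_eq CARD('n) (pf_shift_term x) (pf_shift_term y)"
  proof induction
    case (gen_pow i)
    have "pf_shift_term ((Mul (Gen i) ^^ k) (Const 1)) = (Mul (Gen (Suc i)) ^^ k) (Const 1)" for k
      by (induction k) simp_all
    then show ?case by (simp add: pf_eq.gen_pow)
  qed (auto intro: pf_eq.intros)
qed

lemma pf_shift_simps:
  "pf_shift (pf_const a) = pf_const a"
  "pf_shift (pf_gen i) = pf_gen (Suc i)"
  "pf_shift (x + y) = pf_shift x + pf_shift y"
  "pf_shift (x * y) = pf_shift x * pf_shift y"
  by (transfer, simp add: pf_eq.refl)+

subsection \<open>Trace and conditional expectation\<close>

text \<open>
  \<open>pf_trace\<close> restricts to the trace of each \<open>PF m\<close>. The condition outside \<open>PF (m + 1)\<close> in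
  \<open>pf_cond_exp\<close> only fixes irrelevant values of a total function.
\<close>

definition pf_trace :: "'n::finite pf \<Rightarrow> complex" where
  "pf_trace = (THE t. Vector_Spaces.linear pf_scale (*) t \<and> t 1 = 1 \<and>
     (\<forall>m e. (\<forall>i<m. e i < CARD('n)) \<and> (\<exists>i<m. e i \<noteq> 0) \<longrightarrow> t (pf_monomial m e) = 0))"

definition is_pf_cond_exp :: "nat \<Rightarrow> ('n::finite pf \<Rightarrow> 'n pf) \<Rightarrow> bool" where
  "is_pf_cond_exp m \<Phi> \<longleftrightarrow>
     (\<forall>x\<in>PF (m + 1). \<Phi> x \<in> PF m) \<and>
     (\<forall>x\<in>PF (m + 1). \<forall>y\<in>PF (m + 1). \<Phi> (x + y) = \<Phi> x + \<Phi> y) \<and>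
     (\<forall>a. \<forall>x\<in>PF (m + 1). \<Phi> (pf_scale a x) = pf_scale a (\<Phi> x)) \<and>
     (\<forall>x\<in>PF m. \<Phi> x = x) \<and>
     (\<forall>a\<in>PF m. \<forall>b\<in>PF m. \<forall>x\<in>PF (m + 1). \<Phi> (a * x * b) = a * \<Phi> x * b) \<and>
     (\<forall>x\<in>PF (m + 1). pf_trace (\<Phi> x) = pf_trace x)"

definition pf_cond_exp :: "nat \<Rightarrow> 'n::finite pf \<Rightarrow> 'n pf" where
  "pf_cond_exp m = (THE \<Phi>. is_pf_cond_exp m \<Phi> \<and> (\<forall>x. x \<notin> PF (m + 1) \<longrightarrow> \<Phi> x = 0))"

subsection \<open>String Fourier transform and crossings\<close>

definition pf_E :: "complex \<Rightarrow> nat \<Rightarrow> 'n::finite pf" where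
  "pf_E \<zeta> i = pf_scale (1 / of_real (sqrt CARD('n)))
     (\<Sum>k<CARD('n). pf_scale (\<zeta> ^ k\<^sup>2) (pf_gen i ^ k * pf_gen_inv (i + 1) ^ k))"

text \<open>The transform of an \<open>m\<close>-box; the product runs over strings in decreasing order.\<close>

definition pf_SFT :: "complex \<Rightarrow> nat \<Rightarrow> 'n::finite pf \<Rightarrow> 'n pf" where
  "pf_SFT \<zeta> m x = pf_scale (of_real (sqrt CARD('n)))
     (pf_cond_exp m (prod_list (map (pf_E \<zeta>) (rev [0..<m])) * pf_shift x))"

definition pf_omega :: "nat \<Rightarrow> complex \<Rightarrow> complex" where
  "pf_omega N \<zeta> = 1 / of_real (sqrt (real N)) * (\<Sum>i<N. \<zeta> ^ i\<^sup>2)"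

text \<open>
  The crossings of strings \<open>i\<close> and \<open>i + 1\<close>; the parameter \<open>s\<close> is the chosen square root of
  \<open>pf_omega N \<zeta>\<close>.
\<close>

definition pf_b_minus :: "complex \<Rightarrow> nat \<Rightarrow> 'n::finite pf" where
  "pf_b_minus s i = pf_scale (s / of_real (sqrt CARD('n)))
     (\<Sum>k<CARD('n). pf_gen i ^ k * pf_gen_inv (i + 1) ^ k)"

definition pf_b_plus :: "complex \<Rightarrow> nat \<Rightarrow> 'n::finite pf" where
  "pf_b_plus s i = pf_scale (inverse s / of_real (sqrt CARD('n)))
     (\<Sum>k<CARD('n). pf_gen_inv (i + 1) ^ k * pf_gen i ^ k)"

end

theory Submission
  imports Defs
begin

text \<open>
  Each clause is a finite Fourier computation over the residues modulo \<open>N\<close>, once the trace and the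
  conditional expectation, which are given by definite descriptions, are available in closed form.

  \<^item> Expectation. The relations are stable under multiplying one generator by a power of \<open>q\<close>, so
    there are automorphisms \<open>pf_rot i k\<close> scaling generator \<open>i\<close> by \<open>q ^ k\<close>. Their average over \<open>k\<close>
    (\<open>pf_avg m\<close>, with \<open>i = m\<close>) kills every monomial with a nontrivial power of the last generator
    and fixes \<open>PF m\<close>; it is a trace preserving bimodule map, hence a conditional expectation
    (\<open>is_pf_cond_exp_avg\<close>). It is the only one because the trace form on \<open>PF m\<close> is nondegenerate
    (\<open>is_pf_cond_exp_unique\<close>, \<open>pf_trace_nondegenerate\<close>).

  \<^item> Trace. The algebra is given by generators and relations, so a nonzero functional on it has to
    come from a representation. The regular one, on functions of \<open>\<nat> \<rightarrow> \<int>\<^sub>N\<close>, has a vacuum matrix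
    coefficient that vanishes on nontrivial reduced monomials (\<open>is_pf_trace_exists\<close>); uniqueness holds
    because monomials span (\<open>PF_eq_span\<close>). Distinct monomials are orthogonal since some rotation
    separates their eigenvalues while preserving the trace.

  \<^item> Fourier transform. On boxes \<open>\<Sum> \<alpha>(z) c\<^sub>1\<^sup>z c\<^sub>2\<^sup>-\<^sup>z\<close> the transform acts on \<open>\<alpha>\<close> by an explicit quadratic
    kernel (\<open>pf_SFT_neutral\<close>). The crossing \<open>b\<^sub>-\<close> has constant coefficients and \<open>b\<^sub>+\<close> has
    coefficients proportional to \<open>q\<close> to the power \<open>z\<^sup>2\<close>; completing the square turns either transform
    into a quadratic Gauss sum or its inverse. The product of these two sums is \<open>N\<close>
    (\<open>gauss_mult_inv\<close>), which also shows that \<open>s \<noteq> 0\<close>.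

  \<^item> Reidemeister II and sliding. The product \<open>b\<^sub>+ b\<^sub>-\<close> reduces to orthogonality of characters
    (\<open>pf_b_plus_mult_b_minus\<close>). Shifting the summation index in \<open>b\<^sub>+\<close> gives \<open>c\<^sub>2 b\<^sub>+ = b\<^sub>+ c\<^sub>1\<close>, and generators
    on other strings commute with a crossing because it has degree zero; so generators, and with
    them all boxes, slide under the string (\<open>pf_box_slide_string\<close>).
\<close>

section \<open>Roots of unity and sums over residues\<close>

lemma pf_q_nonzero [simp]: "pf_q N \<noteq> 0"
  by (simp add: pf_q_def)

lemma pf_q_power_eq_1_iff:
  assumes "N > 0"
  shows "pf_q N ^ k = 1 \<longleftrightarrow> N dvd k"
proof -
  have "pf_q N ^ k = exp (2 * of_real pi * \<i> * of_nat k / of_nat N)"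
    unfolding pf_q_def by (subst exp_of_nat_mult [symmetric]) (simp add: field_simps)
  then show ?thesis
    using complex_root_unity_eq_1 [of N k] assms by simp
qed

lemma pf_q_power_mod: "N > 0 \<Longrightarrow> pf_q N ^ (k mod N) = pf_q N ^ k"
  using power_add [of "pf_q N" "N * (k div N)" "k mod N"] pf_q_power_eq_1_iff [of N N]
  by (simp add: power_mult)

lemma power_int_mod:
  fixes x :: "'a::field"
  assumes "x ^ N = 1" "N > 0"
  shows "x powi (z mod int N) = x powi z"
proof -
  have "x \<noteq> 0" using assms by (auto simp: power_0_left)
  moreover have "x powi (int N * (z div int N)) = 1"
    using assms by (simp add: power_int_mult)
  ultimately show ?thesis
    by (metis mult_div_mod_eq power_int_add mult_1)
qed

lemma pf_q_powi_mod: "N > 0 \<Longrightarrow> pf_q N powi (z mod int N) = pf_q N powi z"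
  by (rule power_int_mod) (simp_all add: pf_q_power_eq_1_iff)

lemma pf_q_powi_eq_1_iff:
  assumes "N > 0"
  shows "pf_q N powi z = 1 \<longleftrightarrow> int N dvd z"
proof -
  have "pf_q N powi z = pf_q N ^ nat (z mod int N)"
    using assms pf_q_powi_mod [OF assms, of z]
    by (metis int_nat_eq mod_int_pos_iff of_nat_0_less_iff order_less_imp_le power_int_of_nat)
  moreover have "N dvd nat (z mod int N) \<longleftrightarrow> int N dvd z"
    using assms by (simp add: nat_dvd_iff dvd_mod_iff int_dvd_int_iff flip: int_dvd_int_iff)
  ultimately show ?thesis using assms by (simp add: pf_q_power_eq_1_iff)
qed

lemma pf_q_powi_cong:
  assumes "N > 0" "int N dvd a - b"
  shows "pf_q N powi a = pf_q N powi b"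
  using assms by (metis mod_eq_dvd_iff pf_q_powi_mod)

lemma sum_pf_q_power:
  assumes "N > 0"
  shows "(\<Sum>j<N. pf_q N ^ (j * k)) = (if N dvd k then of_nat N else 0)"
proof (cases "N dvd k")
  case True
  then have "pf_q N ^ (j * k) = 1" for j
    using assms by (simp add: pf_q_power_eq_1_iff)
  then show ?thesis using True by simp
next
  case False
  have "(\<Sum>j<N. pf_q N ^ (j * k)) = (\<Sum>j<N. (pf_q N ^ k) ^ j)"
    by (simp add: mult.commute flip: power_mult)
  also have "\<dots> = ((pf_q N ^ k) ^ N - 1) / (pf_q N ^ k - 1)"
    using False assms by (intro geometric_sum) (simp add: pf_q_power_eq_1_iff)
  also have "(pf_q N ^ k) ^ N = 1"
    using assms by (simp add: pf_q_power_eq_1_iff flip: power_mult)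
  finally show ?thesis using False by simp
qed

lemma sum_residues_int: "(\<Sum>z\<in>{0..<int N}. f z) = (\<Sum>k<N. f (int k))"
  by (rule sum.reindex_bij_witness [where i = int and j = nat]) auto

lemma sum_pf_q_powi:
  assumes "N > 0"
  shows "(\<Sum>j\<in>{0..<int N}. pf_q N powi (j * z)) = (if int N dvd z then of_nat N else 0)"
proof -
  have "pf_q N powi (int j * z) = pf_q N ^ (j * nat (z mod int N))" for j
  proof -
    have "pf_q N powi (int j * z) = pf_q N powi (int j * (z mod int N))"
      using assms by (intro pf_q_powi_cong) (simp_all flip: right_diff_distrib)
    then show ?thesis
      using assms by (simp flip: power_int_of_nat)
  qed
  moreover have "N dvd nat (z mod int N) \<longleftrightarrow> int N dvd z"
    using assms by (simp add: nat_dvd_iff dvd_mod_iff int_dvd_int_iff flip: int_dvd_int_iff)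
  ultimately show ?thesis
    using assms by (simp add: sum_residues_int sum_pf_q_power)
qed

lemma sum_residues_shift:
  fixes f :: "int \<Rightarrow> 'a::comm_monoid_add"
  assumes per: "\<And>z. f (z mod int N) = f z"
  shows "(\<Sum>z\<in>{0..<int N}. f (z + a)) = (\<Sum>z\<in>{0..<int N}. f z)"
  by (rule sum.reindex_bij_witness
      [where i = "\<lambda>z. (z - a) mod int N" and j = "\<lambda>z. (z + a) mod int N"])
     (auto simp: per mod_simps)

lemma sum_residues_reflect:
  fixes f :: "int \<Rightarrow> 'a::comm_monoid_add"
  assumes per: "\<And>z. f (z mod int N) = f z"
  shows "(\<Sum>z\<in>{0..<int N}. f (a - z)) = (\<Sum>z\<in>{0..<int N}. f z)"
  by (rule sum.reindex_bij_witness
      [where i = "\<lambda>z. (a - z) mod int N" and j = "\<lambda>z. (a - z) mod int N"])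
     (auto simp: per mod_simps)

lemma sum_residues_single:
  fixes f :: "int \<Rightarrow> 'a::comm_monoid_add"
  assumes "N > 0" and per: "\<And>z. f (z mod int N) = f z"
  shows "(\<Sum>z\<in>{0..<int N}. if int N dvd z - a then f z else 0) = f a"
proof -
  have "(\<Sum>z\<in>{0..<int N}. if int N dvd z - a then f z else 0) =
      (\<Sum>z\<in>{0..<int N}. if z = a mod int N then f z else 0)"
    by (rule sum.cong) (auto simp flip: mod_eq_dvd_iff)
  then show ?thesis using assms by simp
qed

section \<open>Powers of the generators\<close>

text \<open>
  Exponents are integers, read modulo \<open>N\<close>, so that inverses of generators need no separate treatment
  and sums over exponents can be reindexed by translations and reflections.
\<close>

definition pf_pow :: "nat \<Rightarrow> int \<Rightarrow> 'n::finite pf"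
  where "pf_pow i z = pf_gen i ^ nat (z mod int CARD('n))"

lemma pf_gen_power_mod: "(pf_gen i :: 'n::finite pf) ^ (k mod CARD('n)) = pf_gen i ^ k"
  using power_add [of "pf_gen i :: 'n pf" "CARD('n) * (k div CARD('n))" "k mod CARD('n)"]
  by (simp add: power_mult pf_gen_power_card)

lemma pf_pow_of_nat: "pf_pow i (int k) = (pf_gen i :: 'n::finite pf) ^ k"
  by (simp add: pf_pow_def pf_gen_power_mod flip: zmod_int)

lemma pf_pow_mod: "(pf_pow i (z mod int CARD('n)) :: 'n::finite pf) = pf_pow i z"
  by (simp add: pf_pow_def)

lemma pf_pow_cong: "int CARD('n) dvd a - b \<Longrightarrow> (pf_pow i a :: 'n::finite pf) = pf_pow i b"
  by (simp add: pf_pow_def flip: mod_eq_dvd_iff)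

lemma pf_pow_0 [simp]: "pf_pow i 0 = 1"
  by (simp add: pf_pow_def)

lemma pf_pow_add: "pf_pow i a * pf_pow i b = (pf_pow i (a + b) :: 'n::finite pf)"
proof -
  let ?N = "int CARD('n)"
  have "pf_pow i a * pf_pow i b = (pf_pow i (a mod ?N + b mod ?N) :: 'n pf)"
    using pf_pow_of_nat [of i "nat (a mod ?N) + nat (b mod ?N)", where 'n = 'n]
    by (simp add: pf_pow_def [of i a] pf_pow_def [of i b] power_add)
  also have "\<dots> = pf_pow i (a + b)"
    by (rule pf_pow_cong) (simp add: mod_simps flip: mod_eq_dvd_iff)
  finally show ?thesis .
qed

lemma pf_pow_uminus: "pf_pow i (- int k) = (pf_gen_inv i :: 'n::finite pf) ^ k"
proof -
  have "pf_gen_inv i ^ k = (pf_pow i (int ((CARD('n) - 1) * k)) :: 'n pf)"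
    by (simp only: pf_pow_of_nat pf_gen_inv_def power_mult)
  also have "\<dots> = pf_pow i (- int k)"
    by (rule pf_pow_cong) (simp add: of_nat_diff Suc_leI left_diff_distrib)
  finally show ?thesis by simp
qed

lemmas pf_scale_mult = pf_scale_mult_left pf_scale_mult_right

lemma pf_gen_commute_power:
  assumes "i < j"
  shows "(pf_gen i :: 'n::finite pf) ^ a * pf_gen j ^ b =
    pf_scale (pf_q CARD('n) ^ (a * b)) (pf_gen j ^ b * pf_gen i ^ a)"
proof -
  have one: "(pf_gen i :: 'n pf) * pf_gen j ^ b =
      pf_scale (pf_q CARD('n) ^ b) (pf_gen j ^ b * pf_gen i)" for b
  proof (induction b)
    case (Suc b)
    have "pf_gen i * pf_gen j ^ Suc b = (pf_gen i * pf_gen j) * (pf_gen j :: 'n pf) ^ b"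
      by (simp only: power_Suc mult.assoc)
    also have "\<dots> = pf_scale (pf_q CARD('n)) (pf_gen j * (pf_gen i * pf_gen j ^ b))"
      by (simp only: pf_gen_commute [OF assms] pf_scale_mult mult.assoc)
    also have "\<dots> = pf_scale (pf_q CARD('n) ^ Suc b) (pf_gen j ^ Suc b * pf_gen i)"
      by (simp add: Suc.IH pf_scale_mult mult.assoc)
    finally show ?case .
  qed simp
  show ?thesis
  proof (induction a)
    case (Suc a)
    have "pf_gen i ^ Suc a * pf_gen j ^ b = pf_gen i * ((pf_gen i :: 'n pf) ^ a * pf_gen j ^ b)"
      by (simp only: power_Suc mult.assoc)
    also have "\<dots> = pf_scale (pf_q CARD('n) ^ (a * b)) ((pf_gen i * pf_gen j ^ b) * pf_gen i ^ a)"
      by (simp only: Suc.IH pf_scale_mult mult.assoc)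
    also have "\<dots> = pf_scale (pf_q CARD('n) ^ (Suc a * b)) (pf_gen j ^ b * pf_gen i ^ Suc a)"
      by (simp add: one pf_scale_mult mult.assoc power_add mult.commute)
    finally show ?case .
  qed simp
qed

lemma pf_pow_commute:
  assumes "i < j"
  shows "(pf_pow i a :: 'n::finite pf) * pf_pow j b =
    pf_scale (pf_q CARD('n) powi (a * b)) (pf_pow j b * pf_pow i a)"
proof -
  let ?N = "int CARD('n)"
  have "pf_q CARD('n) ^ (nat (a mod ?N) * nat (b mod ?N)) =
      pf_q CARD('n) powi ((a mod ?N) * (b mod ?N))"
    by (simp flip: power_int_of_nat)
  also have "\<dots> = pf_q CARD('n) powi (a * b)"
    by (rule pf_q_powi_cong) (simp_all add: mod_simps flip: mod_eq_dvd_iff)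
  finally show ?thesis
    using pf_gen_commute_power [OF assms, of "nat (a mod ?N)" "nat (b mod ?N)", where 'n = 'n]
    by (simp add: pf_pow_def)
qed

lemma pf_pow_commute':
  assumes "i < j"
  shows "(pf_pow j b :: 'n::finite pf) * pf_pow i a =
    pf_scale (pf_q CARD('n) powi (- (a * b))) (pf_pow i a * pf_pow j b)"
  by (simp add: pf_pow_commute [OF assms] power_int_minus)

section \<open>Box spaces and their monomials\<close>

lemma one_in_PF: "1 \<in> PF m"
  using PF.const [of 1 m] by (simp add: pf_const_1)

lemma pf_gen_power_in_PF: "i < m \<Longrightarrow> pf_gen i ^ k \<in> PF m"
  by (induction k) (auto simp: one_in_PF intro: PF.mult PF.gen)

lemma pf_pow_in_PF: "i < m \<Longrightarrow> pf_pow i z \<in> PF m"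
  by (simp add: pf_pow_def pf_gen_power_in_PF)

lemma PF_mono: "x \<in> PF m \<Longrightarrow> m \<le> n \<Longrightarrow> x \<in> PF n"
  by (induction rule: PF.induct) (auto intro: PF.intros)

lemma PF_subspace: "pf.subspace (PF m)"
proof (rule pf.subspaceI)
  show "0 \<in> PF m" using PF.const [of 0 m] by (simp add: pf_const_0)
qed (auto simp: pf_scale_def intro: PF.intros)

lemma pf_in_some_PF: "\<exists>m. (x :: 'n::finite pf) \<in> PF m"
proof (induction x rule: pf.abs_induct)
  case (1 t)
  show ?case
  proof (induction t)
    case (Const a)
    then show ?case using PF.const by (metis pf_const.abs_eq)
  next
    case (Gen i)
    then show ?case using PF.gen [of i "Suc i"] by (metis pf_gen.abs_eq lessI)
  next
    case (Add t u)
    then obtain m n where "abs_pf t \<in> (PF m :: 'n pf set)" "abs_pf u \<in> (PF n :: 'n pf set)"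
      by blast
    then have "abs_pf t + abs_pf u \<in> (PF (max m n) :: 'n pf set)"
      by (intro PF.add) (auto intro: PF_mono)
    then show ?case by (auto simp: plus_pf.abs_eq)
  next
    case (Mul t u)
    then obtain m n where "abs_pf t \<in> (PF m :: 'n pf set)" "abs_pf u \<in> (PF n :: 'n pf set)"
      by blast
    then have "abs_pf t * abs_pf u \<in> (PF (max m n) :: 'n pf set)"
      by (intro PF.mult) (auto intro: PF_mono)
    then show ?case by (auto simp: times_pf.abs_eq)
  qed
qed

definition pf_basis :: "nat \<Rightarrow> ('n::finite pf) set"
  where "pf_basis m = {pf_monomial m e | e. \<forall>i<m. e i < CARD('n)}"

lemma pf_monomial_0 [simp]: "pf_monomial 0 e = 1"
  by (simp add: pf_monomial_def)

lemma pf_monomial_Suc: "pf_monomial (Suc m) e = pf_monomial m e * pf_gen m ^ e m"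
  by (simp add: pf_monomial_def)

lemma pf_monomial_cong: "(\<And>i. i < m \<Longrightarrow> e i = e' i) \<Longrightarrow> pf_monomial m e = pf_monomial m e'"
  by (induction m) (simp_all add: pf_monomial_Suc)

lemma pf_monomial_in_PF: "pf_monomial m e \<in> PF m"
proof (induction m)
  case (Suc m)
  then show ?case
    unfolding pf_monomial_Suc
    by (intro PF.mult pf_gen_power_in_PF) (auto intro: PF_mono)
qed (simp add: one_in_PF)

lemma span_mult_right:
  assumes "\<And>b. b \<in> B \<Longrightarrow> b * y \<in> pf.span C" "x \<in> pf.span B"
  shows "x * y \<in> pf.span C"
  using assms(2)
proof (rule pf.span_induct)
  show "pf.subspace {x. x * y \<in> pf.span C}"
    by (rule pf.subspaceI)
       (auto simp: distrib_right pf_scale_mult_left pf.span_zero pf.span_add pf.span_scale)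
qed (use assms(1) in auto)

lemma span_basis_mult_new_gen:
  assumes "x \<in> pf.span (pf_basis m :: 'n::finite pf set)"
  shows "x * pf_gen m ^ k \<in> pf.span (pf_basis (Suc m))"
proof (rule span_mult_right [OF _ assms])
  fix b :: "'n pf" assume "b \<in> pf_basis m"
  then obtain e where e: "b = pf_monomial m e" "\<forall>i<m. e i < CARD('n)"
    by (auto simp: pf_basis_def)
  have "b * pf_gen m ^ k = pf_monomial (Suc m) (e(m := k mod CARD('n)))"
    using e by (simp add: pf_monomial_Suc pf_gen_power_mod cong: pf_monomial_cong)
  moreover have "pf_monomial (Suc m) (e(m := k mod CARD('n))) \<in> (pf_basis (Suc m) :: 'n pf set)"
    using e unfolding pf_basis_def by (auto simp: less_Suc_eq)
  ultimately show "b * pf_gen m ^ k \<in> pf.span (pf_basis (Suc m))"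
    by (auto intro: pf.span_base)
qed

text \<open>
  The step that puts words in normal order: the new factor is moved left past the powers of the
  later generators, which costs only scalars, and is absorbed in the power with its own index.
\<close>

lemma span_basis_mult_gen:
  assumes "i < m" "x \<in> pf.span (pf_basis m :: 'n::finite pf set)"
  shows "x * pf_gen i \<in> pf.span (pf_basis m)"
  using assms
proof (induction m arbitrary: x)
  case (Suc m)
  show ?case
  proof (rule span_mult_right [OF _ Suc.prems(2)])
    fix b :: "'n pf" assume "b \<in> pf_basis (Suc m)"
    then obtain e where e: "b = pf_monomial (Suc m) e" "\<forall>i<Suc m. e i < CARD('n)"
      by (auto simp: pf_basis_def)
    then have base: "pf_monomial m e \<in> pf.span (pf_basis m :: 'n pf set)"
      by (intro pf.span_base) (auto simp: pf_basis_def)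
    show "b * pf_gen i \<in> pf.span (pf_basis (Suc m))"
    proof (cases "i = m")
      case True
      then have "b * pf_gen i = pf_monomial m e * pf_gen m ^ Suc (e m)"
        by (simp only: e(1) pf_monomial_Suc power_Suc2 mult.assoc)
      then show ?thesis using span_basis_mult_new_gen [OF base] by metis
    next
      case False
      then have "i < m" using Suc.prems by simp
      then have "b * pf_gen i = pf_scale (pf_q CARD('n) powi (- int (e m)))
          (pf_monomial m e * pf_gen i * pf_gen m ^ e m)"
        using pf_pow_commute' [of i m "int (e m)" 1, where 'n = 'n]
          pf_pow_of_nat [of i 1, where 'n = 'n]
        by (simp add: e(1) pf_monomial_Suc pf_pow_of_nat mult.assoc pf_scale_mult)
      then show ?thesis
        using span_basis_mult_new_gen [OF Suc.IH [OF \<open>i < m\<close> base]]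
        by (simp add: pf.span_scale)
    qed
  qed
qed simp

lemma PF_eq_span: "PF m = pf.span (pf_basis m :: 'n::finite pf set)"
proof
  have "y * x \<in> pf.span (pf_basis m)" if "x \<in> PF m" "y \<in> pf.span (pf_basis m)" for x y :: "'n pf"
    using that
  proof (induction arbitrary: y rule: PF.induct)
    case (const a)
    then show ?case
      by (metis pf.span_scale pf_const_commute pf_scale_def)
  next
    case (mult x z)
    then show ?case by (metis mult.assoc)
  qed (auto simp: span_basis_mult_gen distrib_left pf.span_add)
  moreover have "1 \<in> pf.span (pf_basis m :: 'n pf set)"
  proof -
    have "pf_monomial m (\<lambda>_. 0) = (1 :: 'n pf)"
      by (induction m) (simp_all add: pf_monomial_Suc)
    then have "1 \<in> (pf_basis m :: 'n pf set)"
      by (force simp: pf_basis_def)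
    then show ?thesis by (rule pf.span_base)
  qed
  ultimately show "PF m \<subseteq> pf.span (pf_basis m :: 'n pf set)"
    by (metis mult_1 subsetI)
  show "pf.span (pf_basis m) \<subseteq> (PF m :: 'n pf set)"
    by (intro pf.span_minimal PF_subspace) (auto simp: pf_basis_def pf_monomial_in_PF)
qed

text \<open>
  The inverse is taken inside the same box space so that it may be used as a test element against
  the trace.
\<close>

lemma pf_monomial_invertible:
  obtains y where "y \<in> PF m" "y * pf_monomial m e = 1" "pf_monomial m e * y = (1 :: 'n::finite pf)"
proof -
  have inv: "pf_pow i (- int k) * pf_gen i ^ k = (1 :: 'n pf)" 
    "pf_gen i ^ k * pf_pow i (- int k) = (1 :: 'n pf)" for i k
    by (simp_all add: pf_pow_add flip: pf_pow_of_nat)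
  have "\<exists>y\<in>PF m. y * pf_monomial m e = 1 \<and> pf_monomial m e * y = (1 :: 'n pf)"
  proof (induction m)
    case (Suc m)
    then obtain y :: "'n pf" where y: "y \<in> PF m" "y * pf_monomial m e = 1" "pf_monomial m e * y = 1"
      by blast
    let ?z = "pf_pow m (- int (e m)) * y"
    have "?z * pf_monomial (Suc m) e =
        pf_pow m (- int (e m)) * (y * pf_monomial m e) * pf_gen m ^ e m"
      by (simp only: pf_monomial_Suc mult.assoc)
    moreover have "pf_monomial (Suc m) e * ?z =
        pf_monomial m e * (pf_gen m ^ e m * pf_pow m (- int (e m))) * y"
      by (simp only: pf_monomial_Suc mult.assoc)
    moreover have "?z \<in> PF (Suc m)"
      using y(1) by (intro PF.mult pf_pow_in_PF) (auto intro: PF_mono)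
    ultimately show ?case by (intro bexI [of _ ?z]) (simp_all add: y inv)
  qed (auto intro: one_in_PF)
  then show ?thesis using that by blast
qed

section \<open>Rotating one generator\<close>

text \<open>
  The automorphism that multiplies generator \<open>i\<close> by \<open>q ^ k\<close>. It is defined on terms with values in
  the quotient, where the relations to be verified are ring identities.
\<close>

primrec pf_rot_term :: "nat \<Rightarrow> nat \<Rightarrow> pf_term \<Rightarrow> 'n::finite pf" where
  "pf_rot_term i k (Const a) = pf_const a"
| "pf_rot_term i k (Gen j) = pf_scale (if j = i then pf_q CARD('n) ^ k else 1) (pf_gen j)"
| "pf_rot_term i k (Add x y) = pf_rot_term i k x + pf_rot_term i k y"
| "pf_rot_term i k (Mul x y) = pf_rot_term i k x * pf_rot_term i k y"

lemma pf_scale_power: "pf_scale a x ^ k = pf_scale (a ^ k) (x ^ k)"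
  by (induction k) (simp_all add: pf_scale_mult ac_simps)

lemma pf_rot_term_cong:
  "pf_eq CARD('n) x y \<Longrightarrow> pf_rot_term i k x = (pf_rot_term i k y :: 'n::finite pf)"
proof (induction rule: pf_eq.induct)
  case (gen_pow j)
  have pow: "pf_rot_term i k ((Mul (Gen j) ^^ l) (Const 1)) = (pf_rot_term i k (Gen j) :: 'n pf) ^ l" for l
    by (induction l) (simp_all add: pf_const_1)
  have "(pf_q CARD('n) ^ k) ^ CARD('n) = 1"
    by (simp add: pf_q_power_eq_1_iff flip: power_mult)
  then show ?case
    unfolding pow by (simp add: pf_scale_power pf_gen_power_card pf_const_1)
next
  case (gen_comm j l)
  have "(pf_gen j :: 'n pf) * pf_gen l = pf_const (pf_q CARD('n)) * (pf_gen l * pf_gen j)"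
    using pf_gen_commute [OF gen_comm, where 'n = 'n] by (simp only: pf_scale_def)
  then show ?case
    by (simp add: pf_scale_mult)
next
  case (add_neg x)
  show ?case
    using pf_scale_def [of "-1" "pf_rot_term i k x :: 'n pf", symmetric] 
    by (simp add: pf_const_0)
next
  case (const_central a x)
  show ?case by (simp add: pf_const_commute)
qed (simp_all add: pf_const_0 pf_const_1 pf_const_add pf_const_mult add.assoc add.commute
      mult.assoc distrib_left distrib_right)

definition pf_rot :: "nat \<Rightarrow> nat \<Rightarrow> 'n::finite pf \<Rightarrow> 'n pf"
  where "pf_rot i k x = pf_rot_term i k (rep_pf x)"

lemma pf_rot_abs: "pf_rot i k (abs_pf t) = (pf_rot_term i k t :: 'n::finite pf)"
proof -
  have "pf_eq CARD('n) (rep_pf (abs_pf t :: 'n pf)) t"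
    by (rule Quotient3_rep_abs [OF Quotient3_pf]) (rule pf_eq.refl)
  then show ?thesis unfolding pf_rot_def by (rule pf_rot_term_cong)
qed

lemma pf_rot_const [simp]: "pf_rot i k (pf_const a) = pf_const a"
  by (simp add: pf_const.abs_eq pf_rot_abs)

lemma pf_rot_gen: "pf_rot i k (pf_gen j :: 'n::finite pf) =
    pf_scale (if j = i then pf_q CARD('n) ^ k else 1) (pf_gen j)"
  by (simp add: pf_gen.abs_eq pf_rot_abs)

lemma pf_rot_add: "pf_rot i k (x + y) = pf_rot i k x + pf_rot i k y"
  by (induction x rule: pf.abs_induct, induction y rule: pf.abs_induct)
     (simp add: plus_pf.abs_eq pf_rot_abs)

lemma pf_rot_mult: "pf_rot i k (x * y) = pf_rot i k x * pf_rot i k y"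
  by (induction x rule: pf.abs_induct, induction y rule: pf.abs_induct)
     (simp add: times_pf.abs_eq pf_rot_abs)

lemma pf_rot_scale: "pf_rot i k (pf_scale a x) = pf_scale a (pf_rot i k x)"
  by (simp add: pf_scale_def pf_rot_mult)

lemma pf_rot_one [simp]: "pf_rot i k 1 = 1"
  by (metis pf_const_1 pf_rot_const)

lemma pf_rot_gen_power: "pf_rot i k ((pf_gen j :: 'n::finite pf) ^ l) =
    pf_scale (if j = i then pf_q CARD('n) ^ (k * l) else 1) (pf_gen j ^ l)"
  by (induction l) (simp_all add: pf_rot_mult pf_rot_gen pf_scale_mult power_add mult.commute)

lemma pf_rot_fixes_PF: "x \<in> PF m \<Longrightarrow> m \<le> i \<Longrightarrow> pf_rot i k x = x"
  by (induction rule: PF.induct) (auto simp: pf_rot_gen pf_rot_add pf_rot_mult)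

lemma pf_rot_monomial: "pf_rot i k (pf_monomial m e :: 'n::finite pf) =
    pf_scale (if i < m then pf_q CARD('n) ^ (k * e i) else 1) (pf_monomial m e)"
  by (induction m)
     (auto simp: pf_monomial_Suc pf_rot_mult pf_rot_gen_power pf_scale_mult less_Suc_eq)

section \<open>The regular representation\<close>

definition residue :: "'n::finite \<Rightarrow> nat"
  where "residue = (SOME h. bij_betw h UNIV {..<CARD('n)})"

lemma residue_bij: "bij_betw residue (UNIV :: 'n::finite set) {..<CARD('n)}"
proof -
  have "\<exists>h. bij_betw h (UNIV :: 'n set) {..<CARD('n)}"
    using ex_bij_betw_finite_nat [of "UNIV :: 'n set"] by (simp add: atLeast0LessThan)
  then show ?thesis unfolding residue_def by (rule someI_ex)
qed

lemma residue_less: "residue (a :: 'n::finite) < CARD('n)"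
  using residue_bij bij_betwE by blast

lemma residue_inject: "residue a = residue (b :: 'n::finite) \<longleftrightarrow> a = b"
  using residue_bij by (metis bij_betw_imp_inj_on injD)

text \<open>
  The type \<open>'n\<close> is identified with the residues modulo its cardinality; \<open>advance\<close> is addition there.
\<close>

definition advance :: "nat \<Rightarrow> 'n::finite \<Rightarrow> 'n"
  where "advance k a = inv residue ((residue a + k) mod CARD('n))"

lemma residue_advance: "residue (advance k a) = (residue a + k) mod CARD('n)" for a :: "'n::finite"
proof -
  have "(residue a + k) mod CARD('n) \<in> range (residue :: 'n \<Rightarrow> nat)"
    using residue_bij [where 'n = 'n] by (simp add: bij_betw_def)
  then show ?thesis unfolding advance_def by (rule f_inv_into_f)
qed

lemma advance_advance: "advance j (advance k a) = advance (j + k) a"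
  by (simp add: residue_advance mod_simps ac_simps flip: residue_inject)

lemma advance_eq_iff: "advance k a = a \<longleftrightarrow> CARD('n) dvd k" for a :: "'n::finite"
proof -
  have "(residue a + k) mod CARD('n) = (residue a + 0) mod CARD('n) \<longleftrightarrow> CARD('n) dvd k"
    by (subst mod_eq_dvd_iff_nat) simp_all
  then show ?thesis
    by (simp add: residue_advance residue_less flip: residue_inject)
qed

text \<open>
  The scalar met when generator \<open>i\<close> crosses the generators with smaller index of the monomial with
  exponents \<open>e\<close>.
\<close>

definition pf_phase :: "nat \<Rightarrow> (nat \<Rightarrow> 'n::finite) \<Rightarrow> complex"
  where "pf_phase i e = pf_q CARD('n) ^ (\<Sum>j<i. residue (e j))"

text \<open>
  The regular representation, realised on functions of all exponent sequences: generator \<open>i\<close> shifts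
  the exponent \<open>i\<close>, and the phase produces the commutation relations.
\<close>

primrec pf_act_term :: "pf_term \<Rightarrow> ((nat \<Rightarrow> 'n::finite) \<Rightarrow> complex) \<Rightarrow> (nat \<Rightarrow> 'n) \<Rightarrow> complex" where
  "pf_act_term (Const a) f = (\<lambda>e. a * f e)"
| "pf_act_term (Gen i) f = (\<lambda>e. pf_phase i e * f (e(i := advance 1 (e i))))"
| "pf_act_term (Add x y) f = (\<lambda>e. pf_act_term x f e + pf_act_term y f e)"
| "pf_act_term (Mul x y) f = pf_act_term x (pf_act_term y f)"

lemma pf_act_term_linear:
  "pf_act_term x (\<lambda>e. a * f e + g e) = (\<lambda>e. a * pf_act_term x f e + pf_act_term x g e)"
  by (induction x arbitrary: f g) (simp_all add: algebra_simps)

lemma pf_act_term_add: "pf_act_term x (\<lambda>e. f e + g e) = (\<lambda>e. pf_act_term x f e + pf_act_term x g e)"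
  using pf_act_term_linear [of x 1] by simp

lemma pf_act_term_scale:
  fixes f :: "(nat \<Rightarrow> 'n::finite) \<Rightarrow> complex"
  shows "pf_act_term x (\<lambda>e. a * f e) = (\<lambda>e. a * pf_act_term x f e)"
proof -
  have "pf_act_term x (\<lambda>e :: nat \<Rightarrow> 'n. 0) = (\<lambda>e. 0)"
    using pf_act_term_linear [of x "-1" "\<lambda>e :: nat \<Rightarrow> 'n. 0" "\<lambda>e. 0"] by simp
  then show ?thesis
    using pf_act_term_linear [of x a f "\<lambda>e. 0"] by simp
qed

lemma pf_phase_upd: "i \<le> j \<Longrightarrow> pf_phase i (e(j := a)) = pf_phase i e"
  by (simp add: pf_phase_def)

lemma pf_phase_advance:
  fixes e :: "nat \<Rightarrow> 'n::finite"
  assumes "i < j"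
  shows "pf_phase j (e(i := advance 1 (e i))) = pf_q CARD('n) * pf_phase j e"
proof -
  let ?N = "CARD('n)"
  have *: "pf_phase j e = pf_q ?N ^ residue (e i) * pf_q ?N ^ (\<Sum>l\<in>{..<j} - {i}. residue (e l))" for e :: "nat \<Rightarrow> 'n"
    using assms by (simp add: pf_phase_def sum.remove [of _ i] flip: power_add)
  have "pf_q ?N ^ residue (advance 1 (e i)) = pf_q ?N * pf_q ?N ^ residue (e i)"
    by (simp add: residue_advance pf_q_power_mod)
  then show ?thesis
    unfolding * by simp
qed

lemma pf_phase_power_card: "pf_phase i e ^ CARD('n) = 1" for e :: "nat \<Rightarrow> 'n::finite"
  by (simp add: pf_phase_def pf_q_power_eq_1_iff flip: power_mult)

lemma pf_act_term_gen_power: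
  "pf_act_term ((Mul (Gen i) ^^ k) (Const 1)) f e = pf_phase i e ^ k * f (e(i := advance k (e i)))"
proof (induction k arbitrary: e)
  case 0
  have "advance 0 (e i) = e i" by (simp add: advance_eq_iff)
  then show ?case by simp
next
  case (Suc k)
  let ?e = "e(i := advance 1 (e i))"
  have "pf_act_term ((Mul (Gen i) ^^ Suc k) (Const 1)) f e =
      pf_phase i e * pf_act_term ((Mul (Gen i) ^^ k) (Const 1)) f ?e"
    by simp
  also have "\<dots> = pf_phase i e * (pf_phase i ?e ^ k * f (?e(i := advance k (?e i))))"
    by (simp only: Suc)
  also have "?e(i := advance k (?e i)) = e(i := advance (Suc k) (e i))"
    by (simp add: advance_advance fun_eq_iff)
  also have "pf_phase i ?e = pf_phase i e"
    by (rule pf_phase_upd) simp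
  finally show ?case
    by (simp only: power_Suc mult.assoc)
qed

lemma pf_act_term_cong:
  "pf_eq CARD('n) x y \<Longrightarrow> pf_act_term x f = pf_act_term y (f :: (nat \<Rightarrow> 'n::finite) \<Rightarrow> complex)"
proof (induction arbitrary: f rule: pf_eq.induct)
  case (gen_pow i)
  have "advance CARD('n) a = a" for a :: 'n by (simp add: advance_eq_iff)
  then show ?case by (simp add: fun_eq_iff pf_act_term_gen_power pf_phase_power_card)
next
  case (gen_comm i j)
  have "pf_phase i e * (pf_phase j (e(i := advance 1 (e i))) *
        f (e(i := advance 1 (e i), j := advance 1 (e j)))) =
      pf_q CARD('n) * (pf_phase j e * (pf_phase i (e(j := advance 1 (e j))) *
        f (e(j := advance 1 (e j), i := advance 1 (e i)))))" for e
    using gen_comm fun_upd_twist [of i j e "advance 1 (e i)" "advance 1 (e j)"]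
    by (simp add: pf_phase_advance pf_phase_upd del: One_nat_def)
  with gen_comm show ?case by (simp add: fun_eq_iff)
next
  case (const_central a x)
  show ?case by (simp add: pf_act_term_scale)
next
  case (distrib_l x y z)
  show ?case by (simp add: pf_act_term_add)
qed (simp_all add: algebra_simps)

lift_definition pf_act :: "'n::finite pf \<Rightarrow> ((nat \<Rightarrow> 'n) \<Rightarrow> complex) \<Rightarrow> (nat \<Rightarrow> 'n) \<Rightarrow> complex"
  is pf_act_term
  by (rule ext) (rule pf_act_term_cong)

lemma pf_act_simps:
  "pf_act (pf_const a) f e = a * f e"
  "pf_act (pf_gen i) f e = pf_phase i e * f (e(i := advance 1 (e i)))"
  "pf_act (x + y) f e = pf_act x f e + pf_act y f e"
  "pf_act (x * y) f = pf_act x (pf_act y f)"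
  by (transfer, simp)+

lemma pf_act_gen_power:
  "pf_act (pf_gen i ^ k) f e = pf_phase i e ^ k * f (e(i := advance k (e i)))"
proof (induction k arbitrary: e)
  case 0
  have "advance 0 (e i) = e i" by (simp add: advance_eq_iff)
  then show ?case using pf_act_simps(1) [of 1] by (simp add: pf_const_1)
next
  case (Suc k)
  let ?e = "e(i := advance 1 (e i))"
  have "pf_act (pf_gen i ^ Suc k) f e = pf_phase i e * pf_act (pf_gen i ^ k) f ?e"
    by (simp add: pf_act_simps)
  also have "\<dots> = pf_phase i e * (pf_phase i ?e ^ k * f (?e(i := advance k (?e i))))"
    by (simp only: Suc)
  also have "?e(i := advance k (?e i)) = e(i := advance (Suc k) (e i))"
    by (simp add: advance_advance fun_eq_iff)
  also have "pf_phase i ?e = pf_phase i e"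
    by (rule pf_phase_upd) simp
  finally show ?case
    by (simp only: power_Suc mult.assoc)
qed

text \<open>
  A monomial acts as a translation up to phases; the translation decides which of its matrix
  coefficients vanish.
\<close>

lemma pf_act_monomial:
  "\<exists>u. pf_act (pf_monomial m x) f e = u * f (\<lambda>i. if i < m then advance (x i) (e i) else e i)"
proof (induction m arbitrary: f)
  case 0
  then show ?case using pf_act_simps(1) [of 1 f e] by (auto simp: pf_const_1)
next
  case (Suc m)
  let ?e = "\<lambda>i. if i < m then advance (x i) (e i) else e i"
  obtain u where u: "pf_act (pf_monomial (Suc m) x) f e = u * pf_act (pf_gen m ^ x m) f ?e"
    using Suc [of "pf_act (pf_gen m ^ x m) f"] by (auto simp: pf_monomial_Suc pf_act_simps)
  have upd: "?e(m := advance (x m) (e m)) = (\<lambda>i. if i < Suc m then advance (x i) (e i) else e i)"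
    by (auto simp: less_Suc_eq)
  have "pf_act (pf_gen m ^ x m) f ?e =
      pf_phase m ?e ^ x m * f (\<lambda>i. if i < Suc m then advance (x i) (e i) else e i)"
    unfolding pf_act_gen_power by (simp add: upd)
  then show ?case by (auto simp: u simp flip: mult.assoc)
qed

section \<open>The trace\<close>

text \<open>
  Every element lies in some box space and each box space is spanned by its reduced monomials, so a
  functional is determined by its values there.
\<close>

lemma linear_functional_eq:
  fixes t u :: "'n::finite pf \<Rightarrow> complex"
  assumes t: "\<And>x y. t (x + y) = t x + t y" "\<And>a x. t (pf_scale a x) = a * t x"
    and u: "\<And>x y. u (x + y) = u x + u y" "\<And>a x. u (pf_scale a x) = a * u x"
    and eq: "\<And>m e. (\<forall>i<m. e i < CARD('n)) \<Longrightarrow> t (pf_monomial m e) = u (pf_monomial m e)"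
  shows "t = u"
proof
  fix x :: "'n pf"
  have zero: "t 0 = 0" "u 0 = 0" using t(2) [of 0 0] u(2) [of 0 0] by simp_all
  obtain m where "x \<in> PF m" using pf_in_some_PF by blast
  then have "x \<in> pf.span (pf_basis m)" by (simp add: PF_eq_span)
  then show "t x = u x"
  proof (rule pf.span_induct)
    show "pf.subspace {x. t x = u x}"
      by (rule pf.subspaceI) (simp_all add: t u zero)
  qed (auto simp: pf_basis_def eq)
qed

lemma pf_monomial_zero_exponents: "(\<And>i. i < m \<Longrightarrow> e i = 0) \<Longrightarrow> pf_monomial m e = 1"
  by (induction m) (simp_all add: pf_monomial_Suc)

definition is_pf_trace :: "('n::finite pf \<Rightarrow> complex) \<Rightarrow> bool" where
  "is_pf_trace t \<longleftrightarrow> Vector_Spaces.linear pf_scale (*) t \<and> t 1 = 1 \<and>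
     (\<forall>m e. (\<forall>i<m. e i < CARD('n)) \<and> (\<exists>i<m. e i \<noteq> 0) \<longrightarrow> t (pf_monomial m e) = 0)"

lemma is_pf_traceD:
  assumes "is_pf_trace (t :: 'n::finite pf \<Rightarrow> complex)"
  shows "t (x + y) = t x + t y" "t (pf_scale a x) = a * t x" "t 1 = 1"
    "\<lbrakk>\<forall>i<m. e i < CARD('n); \<exists>i<m. e i \<noteq> 0\<rbrakk> \<Longrightarrow> t (pf_monomial m e) = 0"
proof -
  interpret Vector_Spaces.linear pf_scale "(*)" t
    using assms by (simp add: is_pf_trace_def)
  show "t (x + y) = t x + t y" "t (pf_scale a x) = a * t x" by (rule add, rule scale)
qed (use assms in \<open>auto simp: is_pf_trace_def\<close>)

lemma is_pf_trace_unique: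
  assumes "is_pf_trace t" "is_pf_trace u"
  shows "t = (u :: 'n::finite pf \<Rightarrow> complex)"
proof (rule linear_functional_eq)
  fix m and e :: "nat \<Rightarrow> nat"
  assume e: "\<forall>i<m. e i < CARD('n)"
  show "t (pf_monomial m e) = u (pf_monomial m e)"
  proof (cases "\<exists>i<m. e i \<noteq> 0")
    case True
    then show ?thesis using e assms by (simp add: is_pf_traceD(4))
  next
    case False
    then have "pf_monomial m e = (1 :: 'n pf)" by (simp add: pf_monomial_zero_exponents)
    then show ?thesis using assms by (simp add: is_pf_traceD(3))
  qed
qed (use assms in \<open>simp_all add: is_pf_traceD\<close>)

text \<open>
  A diagonal matrix coefficient of the regular representation at a point mass. A reduced monomial
  that is not 1 translates the base point away from itself, so its coefficient there is zero.
\<close>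

lemma is_pf_trace_exists: "is_pf_trace (\<lambda>x :: 'n::finite pf.
  pf_act x (\<lambda>e. if e = (\<lambda>_. undefined) then 1 else 0) (\<lambda>_. undefined))"
  (is "is_pf_trace ?t")
  unfolding is_pf_trace_def
proof (intro conjI allI impI)
  have vs: "vector_space ((*) :: complex \<Rightarrow> complex \<Rightarrow> complex)"
    by standard (simp_all add: algebra_simps)
  show "Vector_Spaces.linear pf_scale (*) ?t"
    unfolding Vector_Spaces.linear_iff using vs pf.vector_space_axioms
    by (simp add: pf_scale_def pf_act_simps)
  show "?t 1 = 1" by (simp add: pf_act_simps flip: pf_const_1)
next
  fix m and x :: "nat \<Rightarrow> nat"
  assume x: "(\<forall>i<m. x i < CARD('n)) \<and> (\<exists>i<m. x i \<noteq> 0)"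
  then obtain i where i: "i < m" "x i \<noteq> 0" "x i < CARD('n)" by blast
  let ?e = "\<lambda>_::nat. undefined :: 'n"
  have "advance (x i) undefined \<noteq> (undefined :: 'n)"
    using i by (simp add: advance_eq_iff nat_dvd_not_less)
  then have "(\<lambda>i. if i < m then advance (x i) (?e i) else ?e i) \<noteq> ?e"
    using i(1) by (auto simp: fun_eq_iff)
  then show "?t (pf_monomial m x) = 0"
    using pf_act_monomial [of m x "\<lambda>e. if e = ?e then 1 else 0" ?e] by auto
qed

lemma is_pf_trace_pf_trace: "is_pf_trace pf_trace"
  unfolding pf_trace_def is_pf_trace_def [symmetric]
  using is_pf_trace_exists is_pf_trace_unique [OF _ is_pf_trace_exists] by (rule theI)

lemmas pf_trace_add = is_pf_traceD(1) [OF is_pf_trace_pf_trace]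
  and pf_trace_scale = is_pf_traceD(2) [OF is_pf_trace_pf_trace]
  and pf_trace_one = is_pf_traceD(3) [OF is_pf_trace_pf_trace]
  and pf_trace_monomial = is_pf_traceD(4) [OF is_pf_trace_pf_trace]

lemma pf_trace_zero: "pf_trace 0 = 0"
  using pf_trace_scale [of 0 0] by simp

lemma pf_trace_sum: "pf_trace (sum f A) = (\<Sum>x\<in>A. pf_trace (f x))"
  by (induction A rule: infinite_finite_induct) (simp_all add: pf_trace_zero pf_trace_add)

lemma pf_trace_rot: "pf_trace (pf_rot i k x) = pf_trace (x :: 'n::finite pf)"
proof -
  have "(\<lambda>x :: 'n pf. pf_trace (pf_rot i k x)) = pf_trace"
  proof (rule linear_functional_eq)
    fix m and e :: "nat \<Rightarrow> nat"
    assume e: "\<forall>i<m. e i < CARD('n)"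
    show "pf_trace (pf_rot i k (pf_monomial m e :: 'n pf)) = pf_trace (pf_monomial m e :: 'n pf)"
    proof (cases "\<exists>i<m. e i \<noteq> 0")
      case True
      then show ?thesis using e by (simp add: pf_rot_monomial pf_trace_scale pf_trace_monomial)
    next
      case False
      then have "pf_monomial m e = (1 :: 'n pf)" by (simp add: pf_monomial_zero_exponents)
      then show ?thesis by simp
    qed
  qed (simp_all add: pf_rot_add pf_rot_scale pf_trace_add pf_trace_scale)
  then show ?thesis by metis
qed

text \<open>
  Let \<open>i\<close> be a string where the exponents differ. The inverse \<open>y\<close> is an eigenvector of the rotation
  of generator \<open>i\<close>, with eigenvalue inverse to that of its monomial, so the product is an eigenvector
  with eigenvalue different from 1. As the trace is invariant under rotation, it vanishes there.
\<close>

lemma pf_trace_orthogonal: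
  fixes y :: "'n::finite pf"
  assumes e: "\<forall>i<m. e i < CARD('n)" and f: "\<forall>i<m. f i < CARD('n)"
    and ne: "pf_monomial m f \<noteq> (pf_monomial m e :: 'n pf)"
    and y: "y * pf_monomial m e = 1" "pf_monomial m e * y = 1"
  shows "pf_trace (y * pf_monomial m f) = 0"
proof -
  obtain i where i: "i < m" "e i \<noteq> f i"
    using ne by (metis pf_monomial_cong)
  let ?q = "pf_q CARD('n)"
  let ?z = "pf_scale (?q ^ e i) (pf_rot i 1 y)"
  have "?z * pf_monomial m e = pf_rot i 1 (y * pf_monomial m e)"
    using i by (simp add: pf_rot_mult pf_rot_monomial pf_scale_mult)
  then have z: "?z * pf_monomial m e = 1" by (simp add: y)
  have "?z = (?z * pf_monomial m e) * y"
    by (simp only: mult.assoc y(2) mult_1_right)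
  then have zy: "?z = y" by (simp only: z mult_1_left)
  have "pf_trace (y * pf_monomial m f) = pf_trace (?z * pf_monomial m f)"
    by (simp only: zy)
  then have 1: "pf_trace (y * pf_monomial m f) = ?q ^ e i * pf_trace (pf_rot i 1 y * pf_monomial m f)"
    by (simp only: pf_scale_mult_left pf_trace_scale)
  have "?q ^ f i * pf_trace (pf_rot i 1 y * pf_monomial m f) =
      pf_trace (pf_rot i 1 (y * pf_monomial m f))"
    using i by (simp add: pf_rot_mult pf_rot_monomial pf_scale_mult pf_trace_scale)
  also have "\<dots> = pf_trace (y * pf_monomial m f)" by (rule pf_trace_rot)
  finally have eq: "?q ^ f i * pf_trace (y * pf_monomial m f) = ?q ^ e i * pf_trace (y * pf_monomial m f)"
    by (metis 1 mult.left_commute)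
  have "?q ^ f i \<noteq> ?q ^ e i"
  proof
    assume "?q ^ f i = ?q ^ e i"
    then have "?q powi (int (f i) - int (e i)) = 1"
      by (simp add: power_int_diff)
    then have "int (f i) mod int CARD('n) = int (e i) mod int CARD('n)"
      by (simp add: pf_q_powi_eq_1_iff mod_eq_dvd_iff)
    then show False using i e f by (simp flip: zmod_int)
  qed
  with eq show ?thesis by simp
qed

text \<open>
  Testing against the inverse of a monomial extracts the coefficient of that monomial.
\<close>

lemma pf_trace_nondegenerate:
  fixes d :: "'n::finite pf"
  assumes d: "d \<in> PF m" and orth: "\<And>a. a \<in> PF m \<Longrightarrow> pf_trace (a * d) = 0"
  shows "d = 0"
proof -
  from d obtain t r where t: "finite t" "t \<subseteq> pf_basis m" "d = (\<Sum>a\<in>t. pf_scale (r a) a)"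
    unfolding PF_eq_span pf.span_explicit by blast
  have "r b = 0" if "b \<in> t" for b
  proof -
    obtain e where e: "\<forall>i<m. e i < CARD('n)" "b = pf_monomial m e"
      using t(2) \<open>b \<in> t\<close> by (auto simp: pf_basis_def)
    obtain y :: "'n pf" where y: "y \<in> PF m" "y * b = 1" "b * y = 1"
      using pf_monomial_invertible e(2) by metis
    have "pf_trace (y * a) = (if a = b then 1 else 0)" if "a \<in> t" for a
    proof -
      obtain f where f: "\<forall>i<m. f i < CARD('n)" "a = pf_monomial m f"
        using t(2) \<open>a \<in> t\<close> by (auto simp: pf_basis_def)
      then show ?thesis
        using pf_trace_orthogonal [OF e(1) f(1)] y e(2) by (auto simp: pf_trace_one)
    qed
    then have "(\<Sum>a\<in>t. r a * pf_trace (y * a)) = (\<Sum>a\<in>t. if a = b then r a else 0)"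
      by (intro sum.cong) simp_all
    then have "pf_trace (y * d) = (\<Sum>a\<in>t. if a = b then r a else 0)"
      by (simp add: t(3) sum_distrib_left pf_scale_mult_right pf_trace_sum pf_trace_scale)
    also have "\<dots> = r b" using t(1) \<open>b \<in> t\<close> by simp
    finally show ?thesis using orth [OF y(1)] by simp
  qed
  then show ?thesis by (simp add: t(3))
qed

section \<open>The conditional expectation\<close>

text \<open>
  The projection onto the elements fixed by the rotations of generator \<open>m\<close>.
\<close>

definition pf_avg :: "nat \<Rightarrow> 'n::finite pf \<Rightarrow> 'n pf"
  where "pf_avg m x = pf_scale (1 / of_nat CARD('n)) (\<Sum>k<CARD('n). pf_rot m k x)"

lemma pf_avg_add: "pf_avg m (x + y) = pf_avg m x + pf_avg m y"
  by (simp add: pf_avg_def pf_rot_add sum.distrib pf.scale_right_distrib)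

lemma pf_avg_scale: "pf_avg m (pf_scale a x) = pf_scale a (pf_avg m x)"
  by (simp add: pf_avg_def pf_rot_scale mult.commute flip: pf.scale_sum_right)

lemma pf_avg_bimodule:
  assumes "a \<in> PF m" "b \<in> PF m"
  shows "pf_avg m (a * x * b) = a * pf_avg m x * (b :: 'n::finite pf)"
  by (simp add: pf_avg_def pf_rot_mult pf_rot_fixes_PF [OF assms(1)] pf_rot_fixes_PF [OF assms(2)]
      pf_scale_mult sum_distrib_left sum_distrib_right)

lemma pf_avg_gen_power: "pf_avg m ((pf_gen m :: 'n::finite pf) ^ l) = (if CARD('n) dvd l then 1 else 0)"
proof -
  have "pf_avg m ((pf_gen m :: 'n pf) ^ l) =
      pf_scale ((\<Sum>k<CARD('n). pf_q CARD('n) ^ (k * l)) / of_nat CARD('n)) (pf_gen m ^ l)"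
    by (simp add: pf_avg_def pf_rot_gen_power flip: pf.scale_sum_left)
  then show ?thesis
    using pf_gen_power_mod [of m l, where 'n = 'n] by (auto simp: sum_pf_q_power dvd_eq_mod_eq_0)
qed

lemma pf_avg_mult_gen_power:
  assumes "a \<in> PF m"
  shows "pf_avg m (a * pf_gen m ^ l) = (if CARD('n) dvd l then a else (0 :: 'n::finite pf))"
  using pf_avg_bimodule [OF assms one_in_PF, of "pf_gen m ^ l"] by (simp add: pf_avg_gen_power)

lemma pf_avg_fixes_PF: "x \<in> PF m \<Longrightarrow> pf_avg m x = x"
  using pf_avg_mult_gen_power [of x m 0] by simp

lemma pf_avg_sum: "pf_avg m (sum f A) = (\<Sum>x\<in>A. pf_avg m (f x :: 'n::finite pf))"
proof (induction A rule: infinite_finite_induct)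
  case empty
  show ?case using pf_avg_scale [of m 0 "0 :: 'n pf"] by simp
next
  case (infinite A)
  then show ?case using pf_avg_scale [of m 0 "0 :: 'n pf"] by simp
qed (simp add: pf_avg_add)

lemma pf_avg_mult_pow:
  assumes "a \<in> PF m"
  shows "pf_avg m (a * pf_pow m z) = (if int CARD('n) dvd z then a else (0 :: 'n::finite pf))"
proof -
  have "CARD('n) dvd nat (z mod int CARD('n)) \<longleftrightarrow> int CARD('n) dvd z"
    by (simp add: nat_dvd_iff dvd_mod_iff int_dvd_int_iff flip: int_dvd_int_iff)
  then show ?thesis
    unfolding pf_pow_def pf_avg_mult_gen_power [OF assms] by simp
qed

lemma pf_avg_in_PF:
  assumes "x \<in> PF (m + 1)"
  shows "pf_avg m x \<in> (PF m :: 'n::finite pf set)"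
proof -
  have "x \<in> pf.span (pf_basis (Suc m))" using assms by (simp add: PF_eq_span)
  then show ?thesis
  proof (rule pf.span_induct)
    show "pf.subspace {x. pf_avg m x \<in> (PF m :: 'n pf set)}"
      using PF_subspace [of m, where 'a = 'n] pf_avg_fixes_PF [of "0 :: 'n pf" m]
      by (intro pf.subspaceI) (auto simp: pf_avg_add pf_avg_scale pf.subspace_def)
  next
    fix b :: "'n pf" assume "b \<in> pf_basis (Suc m)"
    then show "pf_avg m b \<in> PF m"
      using PF_subspace [of m, where 'a = 'n]
      by (auto simp: pf_basis_def pf_monomial_Suc pf_avg_mult_gen_power pf_monomial_in_PF
          pf.subspace_def)
  qed
qed

lemma pf_avg_trace: "pf_trace (pf_avg m x) = pf_trace (x :: 'n::finite pf)"
  by (simp add: pf_avg_def pf_trace_scale pf_trace_sum pf_trace_rot)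

lemma is_pf_cond_exp_avg:
  "is_pf_cond_exp m (\<lambda>x :: 'n::finite pf. if x \<in> PF (m + 1) then pf_avg m x else 0)"
proof -
  have "a * x * b \<in> PF (m + 1)" if "a \<in> PF m" "b \<in> PF m" "x \<in> PF (m + 1)" for a b x :: "'n pf"
    using that by (intro PF.mult) (auto intro: PF_mono)
  moreover have "x \<in> PF (m + 1)" if "x \<in> PF m" for x :: "'n pf"
    using that by (auto intro: PF_mono)
  ultimately show ?thesis
    using PF_subspace [of "m + 1", where 'a = 'n]
    by (auto simp: is_pf_cond_exp_def pf_avg_add pf_avg_scale pf_avg_bimodule pf_avg_fixes_PF
        pf_avg_in_PF [simplified] pf_avg_trace PF.add pf.subspace_def)
qed

text \<open>
  The difference of the two values lies in \<open>PF m\<close>. The bimodule property and trace preservation make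
  it orthogonal to \<open>PF m\<close>, since both expectations give \<open>a * x\<close> the same trace.
\<close>

lemma is_pf_cond_exp_unique:
  fixes x :: "'n::finite pf"
  assumes \<Phi>: "is_pf_cond_exp m \<Phi>" and x: "x \<in> PF (m + 1)"
  shows "\<Phi> x = pf_avg m x"
proof -
  have mem: "\<Phi> x - pf_avg m x \<in> PF m"
    using \<Phi> x pf_avg_in_PF [OF x] pf.subspace_diff [OF PF_subspace]
    by (auto simp: is_pf_cond_exp_def)
  have "pf_trace (a * (\<Phi> x - pf_avg m x)) = 0" if a: "a \<in> PF m" for a
  proof -
    have ax: "a * x \<in> PF (m + 1)" using a x by (intro PF.mult) (auto intro: PF_mono)
    have "\<Phi> (a * x * 1) = a * \<Phi> x * 1"
      using \<Phi> a x one_in_PF unfolding is_pf_cond_exp_def by blast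
    moreover have "pf_trace (\<Phi> (a * x)) = pf_trace (a * x)"
      using \<Phi> ax unfolding is_pf_cond_exp_def by blast
    ultimately have "pf_trace (a * \<Phi> x) = pf_trace (a * pf_avg m x)"
      using pf_avg_bimodule [OF a one_in_PF, of x] pf_avg_trace [of m "a * x"] by simp
    moreover have "a * \<Phi> x = a * (\<Phi> x - pf_avg m x) + a * pf_avg m x"
      by (simp flip: distrib_left)
    ultimately show ?thesis by (metis pf_trace_add add_cancel_left_left)
  qed
  then have "\<Phi> x - pf_avg m x = 0" using mem by (rule pf_trace_nondegenerate [rotated])
  then show ?thesis by simp
qed

lemma pf_cond_exp_eq_avg:
  fixes x :: "'n::finite pf"
  assumes "x \<in> PF (m + 1)"
  shows "pf_cond_exp m x = pf_avg m x"
proof -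
  let ?A = "\<lambda>x :: 'n pf. if x \<in> PF (m + 1) then pf_avg m x else 0"
  have "pf_cond_exp m = ?A"
    unfolding pf_cond_exp_def
    by (rule the_equality) (auto simp: is_pf_cond_exp_avg [simplified] is_pf_cond_exp_unique fun_eq_iff)
  then show ?thesis using assms by simp
qed

section \<open>Neutral two-string boxes\<close>

text \<open>
  The box \<open>\<Sum> \<alpha>(z) c\<^sub>i\<^sup>z c\<^sub>i\<^sub>+\<^sub>1\<^sup>-\<^sup>z\<close>, the common shape of \<open>pf_E\<close> and of both crossings.
\<close>

definition pf_neutral :: "(int \<Rightarrow> complex) \<Rightarrow> nat \<Rightarrow> 'n::finite pf" where
  "pf_neutral \<alpha> i = (\<Sum>z\<in>{0..<int CARD('n)}. pf_scale (\<alpha> z) (pf_pow i z * pf_pow (Suc i) (- z)))"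

lemma pf_neutral_cong:
  "(\<And>z. \<alpha> z = \<beta> z) \<Longrightarrow> pf_neutral \<alpha> i = pf_neutral \<beta> i"
  by (simp add: pf_neutral_def)

lemma pf_E_neutral:
  "pf_E \<zeta> i = (pf_neutral (\<lambda>z. \<zeta> powi (z * z) / of_real (sqrt CARD('n))) i :: 'n::finite pf)"
proof -
  have "\<zeta> powi (int k * int k) = \<zeta> ^ k\<^sup>2" for k
    by (simp add: power2_eq_square flip: power_int_of_nat)
  then show ?thesis
    by (simp add: pf_E_def pf_neutral_def sum_residues_int pf_pow_of_nat pf_pow_uminus
        pf.scale_sum_right)
qed

lemma pf_b_minus_neutral:
  "pf_b_minus s i = (pf_neutral (\<lambda>z. s / of_real (sqrt CARD('n))) i :: 'n::finite pf)"
  by (simp add: pf_b_minus_def pf_neutral_def sum_residues_int pf_pow_of_nat pf_pow_uminus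
      pf.scale_sum_right)

lemma pf_b_plus_pow:
  "pf_b_plus s i = (pf_scale (inverse s / of_real (sqrt CARD('n)))
    (\<Sum>z\<in>{0..<int CARD('n)}. pf_pow (Suc i) (- z) * pf_pow i z) :: 'n::finite pf)"
  by (simp add: pf_b_plus_def sum_residues_int pf_pow_of_nat pf_pow_uminus)

text \<open>
  Exchanging the two factors of the summand with index \<open>z\<close> costs \<open>q\<close> to the power \<open>z\<^sup>2\<close>.
\<close>

lemma pf_b_plus_neutral:
  "pf_b_plus s i = (pf_neutral (\<lambda>z. inverse s / of_real (sqrt CARD('n)) *
    pf_q CARD('n) powi (z * z)) i :: 'n::finite pf)"
  by (simp add: pf_b_plus_pow pf_neutral_def pf_pow_commute' pf.scale_sum_right)

lemma pf_neutral_mult: "pf_neutral \<alpha> i * y = (\<Sum>z\<in>{0..<int CARD('n)}.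
    pf_scale (\<alpha> z) (pf_pow i z * pf_pow (Suc i) (- z) * (y :: 'n::finite pf)))"
  by (simp only: pf_neutral_def sum_distrib_right pf_scale_mult)

lemma pf_neutral_in_PF: "Suc i < m \<Longrightarrow> pf_neutral \<alpha> i \<in> (PF m :: 'n::finite pf set)"
  unfolding pf_neutral_def
  by (intro pf.subspace_sum pf.subspace_scale PF_subspace PF.mult pf_pow_in_PF) auto

lemma pf_neutral_graded: "pf_neutral \<alpha> 0 \<in> (PF_graded 2 0 :: 'n::finite pf set)"
  unfolding pf_neutral_def PF_graded_def
proof (intro pf.span_sum pf.span_scale pf.span_base CollectI exI conjI)
  fix z :: int
  let ?N = "int CARD('n)"
  let ?e = "\<lambda>i::nat. if i = 0 then nat (z mod ?N) else nat (- z mod ?N)"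
  show "pf_pow 0 z * pf_pow (Suc 0) (- z) = (pf_monomial 2 ?e :: 'n pf)"
    by (simp add: pf_monomial_def pf_pow_def numeral_2_eq_2)
  show "\<forall>i<2. ?e i < CARD('n)"
    by (simp add: nat_less_iff)
  have "int (nat (z mod ?N) + nat (- z mod ?N)) mod ?N = (z mod ?N + - z mod ?N) mod ?N"
    by simp
  also have "\<dots> = 0" by (simp add: mod_simps)
  finally have "(nat (z mod ?N) + nat (- z mod ?N)) mod CARD('n) = 0"
    by (metis of_nat_eq_0_iff zmod_int)
  then show "(\<Sum>i<2. ?e i) mod CARD('n) = 0 mod CARD('n)"
    by (simp add: numeral_2_eq_2)
qed

lemma pf_shift_power: "pf_shift (x ^ k) = pf_shift x ^ k"
  by (induction k) (use pf_shift_simps(1) [of 1] in \<open>simp_all add: pf_const_1 pf_shift_simps\<close>)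

lemma pf_shift_sum: "pf_shift (sum f A) = (\<Sum>x\<in>A. pf_shift (f x))"
  by (induction A rule: infinite_finite_induct)
     (use pf_shift_simps(1) [of 0] in \<open>simp_all add: pf_const_0 pf_shift_simps\<close>)

lemma pf_shift_neutral: "pf_shift (pf_neutral \<alpha> i) = pf_neutral \<alpha> (Suc i)"
  by (simp add: pf_neutral_def pf_shift_sum pf_scale_def pf_shift_simps pf_pow_def pf_shift_power)

section \<open>Gauss sums\<close>

locale gauss_root =
  fixes N :: nat and \<zeta> :: complex
  assumes N: "N > 0" and zeta_sq: "\<zeta>\<^sup>2 = pf_q N" and zeta_power: "\<zeta> ^ (N\<^sup>2) = 1"
begin

lemma zeta_nonzero: "\<zeta> \<noteq> 0"
  using zeta_sq by auto

lemma zeta_double: "\<zeta> powi (2 * z) = pf_q N powi z"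
  by (simp add: power_int_mult flip: zeta_sq)

lemma zeta_add: "\<zeta> powi (a + b) = \<zeta> powi a * \<zeta> powi b"
  using zeta_nonzero by (simp add: power_int_add)

text \<open>
  The condition that the power of \<open>\<zeta>\<close> with exponent \<open>N\<^sup>2\<close> is 1 enters here: it makes the Gaussian
  \<open>\<zeta>\<close> to the power \<open>z\<^sup>2\<close> periodic in \<open>z\<close> with period \<open>N\<close> rather than \<open>2 N\<close>.
\<close>

lemma zeta_square_shift: "\<zeta> powi ((z + int N * k) * (z + int N * k)) = \<zeta> powi (z * z)"
proof -
  have "(z + int N * k) * (z + int N * k) = z * z + (2 * (int N * (k * z)) + int (N\<^sup>2) * (k * k))"
    by (simp add: algebra_simps power2_eq_square)
  moreover have "\<zeta> powi (int (N\<^sup>2) * (k * k)) = 1"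
    by (simp only: power_int_mult power_int_of_nat zeta_power power_int_1_left)
  moreover have "pf_q N powi (int N * (k * z)) = 1"
    using N by (simp add: pf_q_powi_eq_1_iff)
  ultimately show ?thesis by (simp only: zeta_add zeta_double) simp
qed

lemma zeta_square_mod: "\<zeta> powi ((z mod int N) * (z mod int N)) = \<zeta> powi (z * z)"
  using zeta_square_shift [of "z mod int N" "z div int N"] by simp

lemma zeta_uminus_square_mod: "\<zeta> powi (- ((z mod int N) * (z mod int N))) = \<zeta> powi (- (z * z))"
  by (simp only: power_int_minus zeta_square_mod)

definition gauss :: complex where "gauss = (\<Sum>z\<in>{0..<int N}. \<zeta> powi (z * z))"
definition gauss_inv :: complex where "gauss_inv = (\<Sum>z\<in>{0..<int N}. \<zeta> powi (- (z * z)))"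

lemma pf_omega_gauss: "pf_omega N \<zeta> = gauss / of_real (sqrt N)"
proof -
  have "\<zeta> powi (int k * int k) = \<zeta> ^ k\<^sup>2" for k
    by (simp add: power2_eq_square flip: power_int_of_nat)
  then show ?thesis by (simp add: pf_omega_def gauss_def sum_residues_int)
qed

text \<open>
  The classical evaluation of the modulus of a Gauss sum: substituting \<open>z + w\<close> for \<open>z\<close> in the double
  sum makes the exponent linear in \<open>w\<close>, and summing over \<open>w\<close> leaves only \<open>z = 0\<close>.
\<close>

lemma gauss_mult_inv: "gauss * gauss_inv = of_nat N"
proof -
  let ?R = "{0..<int N}"
  have "gauss * gauss_inv = (\<Sum>w\<in>?R. gauss * \<zeta> powi (- (w * w)))"
    by (simp add: gauss_inv_def sum_distrib_left)
  also have "\<dots> = (\<Sum>w\<in>?R. (\<Sum>z\<in>?R. \<zeta> powi ((z + w) * (z + w))) * \<zeta> powi (- (w * w)))"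
    using sum_residues_shift [of "\<lambda>z. \<zeta> powi (z * z)" N] by (simp add: gauss_def zeta_square_mod)
  also have "\<dots> = (\<Sum>w\<in>?R. \<Sum>z\<in>?R. \<zeta> powi (z * z) * pf_q N powi (w * z))"
    unfolding sum_distrib_right
  proof (intro sum.cong HOL.refl)
    fix w z :: int
    have "(z + w) * (z + w) + - (w * w) = z * z + 2 * (w * z)"
      by (simp add: algebra_simps)
    then show "\<zeta> powi ((z + w) * (z + w)) * \<zeta> powi (- (w * w)) = \<zeta> powi (z * z) * pf_q N powi (w * z)"
      by (metis zeta_add zeta_double)
  qed
  also have "\<dots> = (\<Sum>z\<in>?R. \<zeta> powi (z * z) * (\<Sum>w\<in>?R. pf_q N powi (w * z)))"
    by (subst sum.swap) (simp add: sum_distrib_left)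
  also have "\<dots> = (\<Sum>z\<in>?R. if int N dvd z - 0 then \<zeta> powi (z * z) * of_nat N else 0)"
    using N by (intro sum.cong) (simp_all add: sum_pf_q_powi)
  also have "\<dots> = of_nat N"
    using N by (subst sum_residues_single) (simp_all add: zeta_square_mod)
  finally show ?thesis .
qed

end

section \<open>The string Fourier transform of neutral two-boxes\<close>

text \<open>
  One summand of the product under the expectation. After the two powers of generator 2 have been
  collected on the right, the expectation forces \<open>i = - l\<close> modulo \<open>N\<close>; the remaining scalar records
  the crossings of generators made on the way.
\<close>

lemma pf_avg_three_string_term:
  "pf_avg 2 ((pf_pow 1 l * pf_pow 2 (- l)) * ((pf_pow 0 k * pf_pow 1 (- k)) * (pf_pow 1 i * pf_pow 2 (- i))))
    = (pf_scale (if int CARD('n) dvd i - (- l) then pf_q CARD('n) powi (- (l * l) - k * l) else 0)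
      (pf_pow 0 k * pf_pow 1 (- k)) :: 'n::finite pf)" (is "pf_avg 2 ?T = _")
proof -
  let ?q = "\<lambda>z. pf_q CARD('n) powi z"
  have comm: "pf_pow 2 (- l) * pf_pow 0 k = pf_scale (?q (l * k)) (pf_pow 0 k * pf_pow 2 (- l) :: 'n pf)"
    "pf_pow 2 (- l) * pf_pow 1 (i - k) =
      pf_scale (?q (l * (i - k))) (pf_pow 1 (i - k) * pf_pow 2 (- l) :: 'n pf)"
    "pf_pow 1 l * pf_pow 0 k = pf_scale (?q (- (k * l))) (pf_pow 0 k * pf_pow 1 l :: 'n pf)"
    by (simp_all add: pf_pow_commute' mult.commute)
  have "?T = pf_pow 1 l * ((pf_pow 2 (- l) * pf_pow 0 k) * (pf_pow 1 (- k) * pf_pow 1 i) * pf_pow 2 (- i))"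
    by (simp only: mult.assoc)
  also have "pf_pow 1 (- k) * pf_pow 1 i = (pf_pow 1 (i - k) :: 'n pf)"
    by (simp add: pf_pow_add)
  also have "pf_pow 1 l * ((pf_pow 2 (- l) * pf_pow 0 k) * pf_pow 1 (i - k) * pf_pow 2 (- i)) =
      pf_scale (?q (l * k))
        (pf_pow 1 l * (pf_pow 0 k * (pf_pow 2 (- l) * pf_pow 1 (i - k)) * pf_pow 2 (- i) :: 'n pf))"
    by (simp only: comm(1) pf_scale_mult mult.assoc)
  also have "\<dots> = pf_scale (?q (l * k) * ?q (l * (i - k)))
      ((pf_pow 1 l * pf_pow 0 k) * pf_pow 1 (i - k) * (pf_pow 2 (- l) * pf_pow 2 (- i)))"
    by (simp only: comm(2) pf_scale_mult pf.scale_scale mult.assoc)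
  also have "\<dots> = pf_scale (?q (l * k) * ?q (l * (i - k)) * ?q (- (k * l)))
      (pf_pow 0 k * (pf_pow 1 l * pf_pow 1 (i - k)) * (pf_pow 2 (- l) * pf_pow 2 (- i)))"
    by (simp only: comm(3) pf_scale_mult pf.scale_scale mult.assoc)
  also have "?q (l * k) * ?q (l * (i - k)) * ?q (- (k * l)) = ?q (l * k + l * (i - k) + - (k * l))"
    by (simp only: power_int_add pf_q_nonzero simp_thms)
  also have "l * k + l * (i - k) + - (k * l) = l * i - k * l"
    by (simp add: algebra_simps)
  finally have T: "?T = pf_scale (?q (l * i - k * l)) (pf_pow 0 k * pf_pow 1 (l + (i - k)) * pf_pow 2 (- l - i))"
    by (simp add: pf_pow_add)
  have mem: "pf_pow 0 k * pf_pow 1 (l + (i - k)) \<in> (PF 2 :: 'n pf set)"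
    by (intro PF.mult pf_pow_in_PF) simp_all
  have "int CARD('n) dvd - l - i \<longleftrightarrow> int CARD('n) dvd i - (- l)"
    using dvd_minus_iff [of "int CARD('n)" "i - (- l)"] by (simp add: minus_diff_commute)
  moreover have "pf_pow 1 (l + (i - k)) = (pf_pow 1 (- k) :: 'n pf)" if "int CARD('n) dvd i - (- l)"
    using that by (intro pf_pow_cong) (simp add: algebra_simps)
  moreover have "?q (l * i - k * l) = ?q (- (l * l) - k * l)" if "int CARD('n) dvd i - (- l)"
  proof (rule pf_q_powi_cong)
    have "l * i - k * l - (- (l * l) - k * l) = l * (i - (- l))" by (simp add: algebra_simps)
    then show "int CARD('n) dvd l * i - k * l - (- (l * l) - k * l)"
      using that by (metis dvd_mult)
  qed simp
  ultimately show ?thesis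
    unfolding T pf_avg_scale pf_avg_mult_pow [OF mem] by simp
qed

text \<open>
  The expectation identifies the index of the box with minus the index of \<open>E\<close> on strings 1 and 2,
  leaving a sum over \<open>l\<close>. The exponent of \<open>\<zeta>\<close> collects \<open>l\<^sup>2 + k\<^sup>2\<close> from the two factors \<open>E\<close> and
  \<open>- 2 l\<^sup>2 - 2 k l\<close> from reordering the generators.
\<close>

lemma pf_SFT_neutral:
  assumes "gauss_root CARD('n) \<zeta>"
    and per: "\<And>z. \<alpha> (z mod int CARD('n)) = \<alpha> z"
  shows "pf_SFT \<zeta> 2 (pf_neutral \<alpha> 0) = (pf_neutral (\<lambda>k. (\<Sum>l\<in>{0..<int CARD('n)}.
      \<zeta> powi (k * k - l * l - 2 * (k * l)) * \<alpha> (- l)) / of_real (sqrt CARD('n))) 0 :: 'n::finite pf)"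
proof -
  interpret gauss_root "CARD('n)" \<zeta> by fact
  let ?R = "{0..<int CARD('n)}" and ?r = "complex_of_real (sqrt CARD('n))"
  let ?q = "\<lambda>z. pf_q CARD('n) powi z"
  let ?g = "\<lambda>z. \<zeta> powi (z * z) / ?r"
  let ?c = "\<lambda>k. pf_pow 0 k * pf_pow 1 (- k) :: 'n pf"
  have r: "?r \<noteq> 0" by simp
  have mem: "pf_neutral ?g 1 * (pf_neutral ?g 0 * pf_neutral \<alpha> 1) \<in> (PF (2 + 1) :: 'n pf set)"
    by (intro PF.mult pf_neutral_in_PF) simp_all
  have "prod_list (map (pf_E \<zeta>) (rev [0..<2])) * pf_shift (pf_neutral \<alpha> 0) =
      (pf_neutral ?g 1 * (pf_neutral ?g 0 * pf_neutral \<alpha> 1) :: 'n pf)"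
    by (simp add: numeral_2_eq_2 pf_E_neutral pf_shift_neutral mult.assoc)
  then have "pf_SFT \<zeta> 2 (pf_neutral \<alpha> 0) =
      pf_scale ?r (pf_avg 2 (pf_neutral ?g 1 * (pf_neutral ?g 0 * pf_neutral \<alpha> 1) :: 'n pf))"
    by (simp only: pf_SFT_def pf_cond_exp_eq_avg [OF mem])
  also have "pf_avg 2 (pf_neutral ?g 1 * (pf_neutral ?g 0 * pf_neutral \<alpha> 1) :: 'n pf) =
      (\<Sum>l\<in>?R. \<Sum>k\<in>?R. \<Sum>i\<in>?R. pf_scale (?g l * (?g k * \<alpha> i)) (pf_avg 2
        ((pf_pow 1 l * pf_pow 2 (- l)) * (?c k * (pf_pow 1 i * pf_pow 2 (- i))))))"
    unfolding pf_neutral_mult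
    by (simp only: pf_neutral_def [of \<alpha>] sum_distrib_left pf_avg_sum pf_avg_scale
        pf_scale_mult pf.scale_sum_right pf.scale_scale numeral_2_eq_2 One_nat_def)
  also have "\<dots> = (\<Sum>l\<in>?R. \<Sum>k\<in>?R. pf_scale (?g l * ?g k * ?q (- (l * l) - k * l) * \<alpha> (- l)) (?c k))"
  proof (intro sum.cong HOL.refl)
    fix l k :: int
    have "(\<Sum>i\<in>?R. pf_scale (?g l * (?g k * \<alpha> i)) (pf_avg 2
        ((pf_pow 1 l * pf_pow 2 (- l)) * (?c k * (pf_pow 1 i * pf_pow 2 (- i)))))) =
      (\<Sum>i\<in>?R. pf_scale (if int CARD('n) dvd i - (- l)
        then ?g l * ?g k * ?q (- (l * l) - k * l) * \<alpha> i else 0) (?c k))"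
      unfolding pf_avg_three_string_term by (intro sum.cong) (simp_all add: ac_simps)
    also have "\<dots> = pf_scale (\<Sum>i\<in>?R. if int CARD('n) dvd i - (- l)
        then ?g l * ?g k * ?q (- (l * l) - k * l) * \<alpha> i else 0) (?c k)"
      by (simp only: pf.scale_sum_left)
    also have "(\<Sum>i\<in>?R. if int CARD('n) dvd i - (- l)
        then ?g l * ?g k * ?q (- (l * l) - k * l) * \<alpha> i else 0) =
        ?g l * ?g k * ?q (- (l * l) - k * l) * \<alpha> (- l)"
      by (rule sum_residues_single) (simp_all add: per)
    finally show "(\<Sum>i\<in>?R. pf_scale (?g l * (?g k * \<alpha> i)) (pf_avg 2
        ((pf_pow 1 l * pf_pow 2 (- l)) * (?c k * (pf_pow 1 i * pf_pow 2 (- i)))))) =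
      pf_scale (?g l * ?g k * ?q (- (l * l) - k * l) * \<alpha> (- l)) (?c k)" .
  qed
  also have "\<dots> = (\<Sum>k\<in>?R. \<Sum>l\<in>?R. pf_scale (?g l * ?g k * ?q (- (l * l) - k * l) * \<alpha> (- l)) (?c k))"
    by (rule sum.swap)
  also have "pf_scale ?r \<dots> =
      (\<Sum>k\<in>?R. pf_scale (\<Sum>l\<in>?R. ?r * (?g l * ?g k * ?q (- (l * l) - k * l) * \<alpha> (- l))) (?c k))"
    by (simp only: pf.scale_sum_right pf.scale_sum_left pf.scale_scale)
  also have "\<dots> = (\<Sum>k\<in>?R. pf_scale ((\<Sum>l\<in>?R.
      \<zeta> powi (k * k - l * l - 2 * (k * l)) * \<alpha> (- l)) / ?r) (?c k))"
  proof (intro sum.cong HOL.refl arg_cong2 [where f = pf_scale])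
    fix k :: int
    have "?r * (?g l * ?g k * ?q (- (l * l) - k * l) * \<alpha> (- l)) =
        \<zeta> powi (k * k - l * l - 2 * (k * l)) * \<alpha> (- l) / ?r" for l
    proof -
      have "k * k - l * l - 2 * (k * l) = l * l + k * k + 2 * (- (l * l) - k * l)"
        by (simp add: algebra_simps)
      then have "\<zeta> powi (k * k - l * l - 2 * (k * l)) =
          \<zeta> powi (l * l) * \<zeta> powi (k * k) * ?q (- (l * l) - k * l)"
        by (simp only: zeta_add zeta_double)
      then show ?thesis using r by simp
    qed
    then show "(\<Sum>l\<in>?R. ?r * (?g l * ?g k * ?q (- (l * l) - k * l) * \<alpha> (- l))) =
        (\<Sum>l\<in>?R. \<zeta> powi (k * k - l * l - 2 * (k * l)) * \<alpha> (- l)) / ?r"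
      by (simp only: sum_divide_distrib)
  qed
  finally show ?thesis by (simp add: pf_neutral_def)
qed

section \<open>The crossings\<close>

context gauss_root
begin

lemma gauss_eq: "s\<^sup>2 = pf_omega N \<zeta> \<Longrightarrow> gauss = s\<^sup>2 * of_real (sqrt N)"
  using N by (simp add: pf_omega_gauss)

lemma gauss_inv_eq:
  assumes "s\<^sup>2 = pf_omega N \<zeta>"
  shows "s \<noteq> 0" "gauss_inv = inverse (s\<^sup>2) * of_real (sqrt N)"
proof -
  let ?r = "complex_of_real (sqrt N)"
  have rr: "?r * ?r = of_nat N" by (simp flip: of_real_mult)
  have r: "?r \<noteq> 0" using N by simp
  have eq: "s\<^sup>2 * ?r * gauss_inv = ?r * ?r"
    using gauss_mult_inv gauss_eq [OF assms] rr by simp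
  show "s \<noteq> 0" using eq r by auto
  then show "gauss_inv = inverse (s\<^sup>2) * ?r"
    using eq r by (simp add: field_simps)
qed

end

text \<open>
  The coefficients of \<open>b\<^sub>+\<close> add \<open>2 l\<^sup>2\<close> to the exponent of the kernel, which becomes the square of
  \<open>k - l\<close>; the sum over \<open>l\<close> is then the full Gauss sum, independent of \<open>k\<close>.
\<close>

lemma pf_SFT_b_plus:
  assumes "gauss_root CARD('n) \<zeta>" and s: "s\<^sup>2 = pf_omega CARD('n) \<zeta>"
  shows "pf_SFT \<zeta> 2 (pf_b_plus s 0) = (pf_b_minus s 0 :: 'n::finite pf)"
proof -
  interpret gauss_root "CARD('n)" \<zeta> by fact
  let ?R = "{0..<int CARD('n)}" and ?r = "complex_of_real (sqrt CARD('n))"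
  let ?a = "\<lambda>z. inverse s / ?r * pf_q CARD('n) powi (z * z)"
  have per: "?a (z mod int CARD('n)) = ?a z" for z
    using pf_q_powi_cong [of "CARD('n)" "(z mod int CARD('n)) * (z mod int CARD('n))" "z * z"]
    by (simp add: mod_simps flip: mod_eq_dvd_iff)
  have "(\<Sum>l\<in>?R. \<zeta> powi (k * k - l * l - 2 * (k * l)) * ?a (- l)) / ?r = s / ?r" for k
  proof -
    have "(\<Sum>l\<in>?R. \<zeta> powi (k * k - l * l - 2 * (k * l)) * ?a (- l)) =
        (\<Sum>l\<in>?R. inverse s / ?r * \<zeta> powi ((k - l) * (k - l)))"
    proof (intro sum.cong HOL.refl)
      fix l
      have "(k - l) * (k - l) = (k * k - l * l - 2 * (k * l)) + 2 * (- l * - l)"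
        by (simp add: algebra_simps)
      then have "\<zeta> powi ((k - l) * (k - l)) =
          \<zeta> powi (k * k - l * l - 2 * (k * l)) * pf_q CARD('n) powi (- l * - l)"
        by (simp only: zeta_add zeta_double)
      then show "\<zeta> powi (k * k - l * l - 2 * (k * l)) * ?a (- l) =
          inverse s / ?r * \<zeta> powi ((k - l) * (k - l))"
        by simp
    qed
    also have "\<dots> = inverse s / ?r * gauss"
      using sum_residues_reflect [of "\<lambda>z. \<zeta> powi (z * z)" "CARD('n)" k]
      by (simp only: gauss_def zeta_square_mod sum_distrib_left [symmetric])
    also have "\<dots> = s"
      using gauss_inv_eq(1) [OF s] by (simp add: gauss_eq [OF s] power2_eq_square)
    finally show ?thesis by simp
  qed
  then show ?thesis
    unfolding pf_b_plus_neutral pf_b_minus_neutral pf_SFT_neutral [OF assms(1), of ?a, OF per]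
    by (intro pf_neutral_cong)
qed

text \<open>
  Here the exponent of the kernel is \<open>2 k\<^sup>2\<close> minus the square of \<open>l + k\<close>: the sum over \<open>l\<close> is the
  inverse Gauss sum, and \<open>2 k\<^sup>2\<close> yields the coefficients of \<open>b\<^sub>+\<close>.
\<close>

lemma pf_SFT_b_minus:
  assumes "gauss_root CARD('n) \<zeta>" and s: "s\<^sup>2 = pf_omega CARD('n) \<zeta>"
  shows "pf_SFT \<zeta> 2 (pf_b_minus s 0) = (pf_b_plus s 0 :: 'n::finite pf)"
proof -
  interpret gauss_root "CARD('n)" \<zeta> by fact
  let ?R = "{0..<int CARD('n)}" and ?r = "complex_of_real (sqrt CARD('n))"
  have "(\<Sum>l\<in>?R. \<zeta> powi (k * k - l * l - 2 * (k * l)) * (s / ?r)) / ?r =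
      inverse s / ?r * pf_q CARD('n) powi (k * k)" for k
  proof -
    have "(\<Sum>l\<in>?R. \<zeta> powi (k * k - l * l - 2 * (k * l)) * (s / ?r)) =
        (\<Sum>l\<in>?R. s / ?r * pf_q CARD('n) powi (k * k) * \<zeta> powi (- ((l + k) * (l + k))))"
    proof (intro sum.cong HOL.refl)
      fix l
      have "k * k - l * l - 2 * (k * l) = 2 * (k * k) + - ((l + k) * (l + k))"
        by (simp add: algebra_simps)
      then have "\<zeta> powi (k * k - l * l - 2 * (k * l)) =
          pf_q CARD('n) powi (k * k) * \<zeta> powi (- ((l + k) * (l + k)))"
        by (simp only: zeta_add zeta_double)
      then show "\<zeta> powi (k * k - l * l - 2 * (k * l)) * (s / ?r) =
          s / ?r * pf_q CARD('n) powi (k * k) * \<zeta> powi (- ((l + k) * (l + k)))"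
        by simp
    qed
    also have "\<dots> = s / ?r * pf_q CARD('n) powi (k * k) * gauss_inv"
      using sum_residues_shift [of "\<lambda>z. \<zeta> powi (- (z * z))" "CARD('n)" k]
      by (simp only: gauss_inv_def zeta_uminus_square_mod sum_distrib_left [symmetric])
    also have "\<dots> = inverse s * pf_q CARD('n) powi (k * k)"
      using gauss_inv_eq(1) [OF s]
      by (simp add: gauss_inv_eq(2) [OF s] power2_eq_square field_simps)
    finally show ?thesis by simp
  qed
  then show ?thesis
    unfolding pf_b_plus_neutral pf_b_minus_neutral
      pf_SFT_neutral [OF assms(1), of "\<lambda>_. s / ?r", OF HOL.refl]
    by (intro pf_neutral_cong)
qed

text \<open>
  Collecting the terms of total exponent \<open>k\<close> leaves the sum over \<open>a\<close> of \<open>q\<close> to the power \<open>a k\<close>, which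
  vanishes unless \<open>k = 0\<close>.
\<close>

lemma pf_b_plus_mult_b_minus:
  assumes "s \<noteq> 0"
  shows "pf_b_plus s i * pf_b_minus s i = (1 :: 'n::finite pf)"
proof -
  let ?R = "{0..<int CARD('n)}" and ?r = "complex_of_real (sqrt CARD('n))"
  let ?q = "\<lambda>z. pf_q CARD('n) powi z"
  let ?c = "\<lambda>k. pf_pow i k * pf_pow (Suc i) (- k) :: 'n pf"
  have rr: "?r * ?r = of_nat CARD('n)" by (simp flip: of_real_mult)
  have c: "?c a * ?c b = pf_scale (?q (a * b)) (?c (a + b))" for a b
  proof -
    have "?c a * ?c b = pf_pow i a * (pf_pow (Suc i) (- a) * pf_pow i b) * pf_pow (Suc i) (- b)"
      by (simp only: mult.assoc)
    also have "\<dots> = pf_scale (?q (a * b))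
        ((pf_pow i a * pf_pow i b) * (pf_pow (Suc i) (- a) * pf_pow (Suc i) (- b)))"
      by (simp add: pf_pow_commute' pf_scale_mult mult.assoc mult.commute)
    finally show ?thesis by (simp add: pf_pow_add)
  qed
  have coeff: "inverse s / ?r * ?q (a * a) * (s / ?r) * ?q (a * b) = 1 / of_nat CARD('n) * ?q (a * (b + a))" for a b
  proof -
    have "?q (a * (b + a)) = ?q (a * b) * ?q (a * a)"
      by (simp add: distrib_left power_int_add)
    then show ?thesis using assms rr by (simp add: field_simps)
  qed
  have "pf_b_plus s i * pf_b_minus s i = (\<Sum>a\<in>?R. \<Sum>b\<in>?R.
      pf_scale (inverse s / ?r * ?q (a * a) * (s / ?r)) (?c a * ?c b))"
    unfolding pf_b_plus_neutral pf_b_minus_neutral pf_neutral_mult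
    by (simp only: pf_neutral_def [of "\<lambda>z. s / ?r"] sum_distrib_left pf_scale_mult pf.scale_sum_right pf.scale_scale)
  also have "\<dots> = (\<Sum>a\<in>?R. \<Sum>b\<in>?R. pf_scale (1 / of_nat CARD('n) * ?q (a * (b + a))) (?c (b + a)))"
    by (simp only: c pf.scale_scale coeff add.commute)
  also have "\<dots> = (\<Sum>a\<in>?R. \<Sum>k\<in>?R. pf_scale (1 / of_nat CARD('n) * ?q (a * k)) (?c k))"
  proof (rule sum.cong [OF HOL.refl])
    fix a
    have "?q (a * (z mod int CARD('n))) = ?q (a * z)" for z
      by (rule pf_q_powi_cong) (simp_all add: mod_simps flip: mod_eq_dvd_iff)
    moreover have "?c (z mod int CARD('n)) = ?c z" for z
    proof -
      have "pf_pow (Suc i) (- (z mod int CARD('n))) = (pf_pow (Suc i) (- z) :: 'n pf)"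
        by (rule pf_pow_cong) (simp add: mod_simps flip: mod_eq_dvd_iff)
      then show ?thesis by (simp only: pf_pow_mod)
    qed
    ultimately show "(\<Sum>b\<in>?R. pf_scale (1 / of_nat CARD('n) * ?q (a * (b + a))) (?c (b + a))) =
        (\<Sum>k\<in>?R. pf_scale (1 / of_nat CARD('n) * ?q (a * k)) (?c k))"
      by (intro sum_residues_shift) (simp only:)
  qed
  also have "\<dots> = (\<Sum>k\<in>?R. pf_scale (1 / of_nat CARD('n) * (\<Sum>a\<in>?R. ?q (a * k))) (?c k))"
    by (subst sum.swap) (simp only: pf.scale_sum_left sum_distrib_left)
  also have "\<dots> = (\<Sum>k\<in>?R. if k = 0 then 1 else 0)"
    by (intro sum.cong HOL.refl) (auto simp: sum_pf_q_powi dest: zdvd_imp_le)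
  also have "\<dots> = 1" by simp
  finally show ?thesis .
qed

section \<open>Boxes sliding under a string\<close>

lemma pf_gen_eq_pow: "pf_gen i = (pf_pow i 1 :: 'n::finite pf)"
  using pf_pow_of_nat [of i 1, where 'n = 'n] by simp

text \<open>
  Multiplying by the generator on either side raises one of the exponents by one; the two sums
  agree after translating the index.
\<close>

lemma pf_gen_mult_b_plus: "pf_gen (Suc i) * pf_b_plus s i = pf_b_plus s i * (pf_gen i :: 'n::finite pf)"
proof -
  let ?R = "{0..<int CARD('n)}"
  let ?f = "\<lambda>z. pf_pow (Suc i) (1 - z) * pf_pow i z :: 'n pf"
  have per: "?f (z mod int CARD('n)) = ?f z" for z
  proof -
    have "pf_pow (Suc i) (1 - z mod int CARD('n)) = (pf_pow (Suc i) (1 - z) :: 'n pf)"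
      by (rule pf_pow_cong) (simp add: mod_simps flip: mod_eq_dvd_iff)
    then show ?thesis by (simp only: pf_pow_mod)
  qed
  have "pf_gen (Suc i) * (\<Sum>z\<in>?R. pf_pow (Suc i) (- z) * pf_pow i z) = (\<Sum>z\<in>?R. ?f z)"
    by (simp add: pf_gen_eq_pow sum_distrib_left pf_pow_add flip: mult.assoc)
  also have "\<dots> = (\<Sum>z\<in>?R. ?f (z + 1))"
    using sum_residues_shift [of ?f "CARD('n)" 1] per by simp
  also have "\<dots> = (\<Sum>z\<in>?R. pf_pow (Suc i) (- z) * pf_pow i z) * pf_gen i"
    by (simp add: pf_gen_eq_pow sum_distrib_right pf_pow_add mult.assoc)
  finally show ?thesis by (simp add: pf_b_plus_pow pf_scale_mult)
qed

text \<open>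
  Passing the two factors \<open>c\<^sub>i\<^sup>z\<close> and \<open>c\<^sub>i\<^sub>+\<^sub>1\<^sup>-\<^sup>z\<close>, which lie on the same side of string \<open>j\<close>, produces
  inverse scalars.
\<close>

lemma pf_gen_commute_neutral:
  assumes "j < i \<or> Suc i < j"
  shows "pf_gen j * pf_neutral \<alpha> i = pf_neutral \<alpha> i * (pf_gen j :: 'n::finite pf)"
proof -
  have "pf_pow j 1 * (pf_pow i z * pf_pow (Suc i) (- z)) =
      (pf_pow i z * pf_pow (Suc i) (- z)) * (pf_pow j 1 :: 'n pf)" for z
  proof (cases "j < i")
    case True
    have "pf_pow j 1 * (pf_pow i z * pf_pow (Suc i) (- z)) =
        (pf_pow j 1 * pf_pow i z) * (pf_pow (Suc i) (- z) :: 'n pf)"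
      by (simp only: mult.assoc)
    also have "\<dots> = pf_scale (pf_q CARD('n) powi z) (pf_pow i z * (pf_pow j 1 * pf_pow (Suc i) (- z)))"
      using True by (simp add: pf_pow_commute [of j i] pf_scale_mult mult.assoc)
    also have "\<dots> = pf_pow i z * pf_pow (Suc i) (- z) * pf_pow j 1"
      using True by (simp add: pf_pow_commute [of j "Suc i"] pf_scale_mult mult.assoc power_int_minus)
    finally show ?thesis .
  next
    case False
    with assms have j: "Suc i < j" by simp
    have "pf_pow j 1 * (pf_pow i z * pf_pow (Suc i) (- z)) =
        (pf_pow j 1 * pf_pow i z) * (pf_pow (Suc i) (- z) :: 'n pf)"
      by (simp only: mult.assoc)
    also have "\<dots> = pf_scale (pf_q CARD('n) powi (- z)) (pf_pow i z * (pf_pow j 1 * pf_pow (Suc i) (- z)))"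
      using j by (simp add: pf_pow_commute' [of i j] pf_scale_mult mult.assoc)
    also have "\<dots> = pf_pow i z * pf_pow (Suc i) (- z) * pf_pow j 1"
      using j by (simp add: pf_pow_commute' [of "Suc i" j] pf_scale_mult mult.assoc power_int_minus)
    finally show ?thesis .
  qed
  then show ?thesis
    by (simp only: pf_neutral_def pf_gen_eq_pow sum_distrib_left sum_distrib_right pf_scale_mult)
qed

lemma pf_gen_commute_string:
  assumes "m < j"
  shows "pf_gen j * prod_list (map (pf_b_plus s) [0..<m]) =
    prod_list (map (pf_b_plus s) [0..<m]) * (pf_gen j :: 'n::finite pf)"
  using assms
proof (induction m)
  case (Suc m)
  let ?P = "prod_list (map (pf_b_plus s) [0..<m]) :: 'n pf"
  have "pf_gen j * (?P * pf_b_plus s m) = ?P * (pf_gen j * pf_b_plus s m)"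
    using Suc by (simp flip: mult.assoc)
  also have "pf_gen j * pf_b_plus s m = pf_b_plus s m * (pf_gen j :: 'n pf)"
    unfolding pf_b_plus_neutral using Suc.prems by (intro pf_gen_commute_neutral) simp
  finally show ?case by (simp add: mult.assoc)
qed simp

text \<open>
  Generator \<open>i + 1\<close> passes the crossings before the one on strings \<open>i\<close> and \<open>i + 1\<close>, becomes generator
  \<open>i\<close> there, and passes the later ones.
\<close>

lemma pf_gen_slide_string:
  assumes "i < m"
  shows "pf_gen (Suc i) * prod_list (map (pf_b_plus s) [0..<m]) =
    prod_list (map (pf_b_plus s) [0..<m]) * (pf_gen i :: 'n::finite pf)"
  using assms
proof (induction m)
  case (Suc m)
  let ?P = "prod_list (map (pf_b_plus s) [0..<m]) :: 'n pf" and ?b = "pf_b_plus s m :: 'n pf"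
  have "pf_gen (Suc i) * (?P * ?b) = ?P * ?b * pf_gen i"
  proof (cases "i = m")
    case True
    have "pf_gen (Suc m) * (?P * ?b) = ?P * (pf_gen (Suc m) * ?b)"
      by (simp only: pf_gen_commute_string [of m "Suc m", OF lessI] mult.assoc [symmetric])
    then show ?thesis by (simp only: True pf_gen_mult_b_plus mult.assoc)
  next
    case False
    with Suc.prems have i: "i < m" by simp
    have "pf_gen (Suc i) * (?P * ?b) = ?P * (pf_gen i * ?b)"
      by (simp only: Suc.IH [OF i] mult.assoc [symmetric])
    also have "pf_gen i * ?b = ?b * pf_gen i"
      unfolding pf_b_plus_neutral using i by (intro pf_gen_commute_neutral) simp
    finally show ?thesis by (simp only: mult.assoc)
  qed
  then show ?case by simp
qed simp

lemma pf_box_slide_string: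
  assumes "x \<in> PF m"
  shows "pf_shift x * prod_list (map (pf_b_plus s) [0..<m]) =
    prod_list (map (pf_b_plus s) [0..<m]) * (x :: 'n::finite pf)"
  using assms
proof induction
  case (const a)
  show ?case by (simp add: pf_shift_simps pf_const_commute)
next
  case (gen i)
  then show ?case by (simp add: pf_shift_simps pf_gen_slide_string)
next
  case (add x y)
  then show ?case by (simp add: pf_shift_simps distrib_left distrib_right)
next
  case (mult x y)
  let ?P = "prod_list (map (pf_b_plus s) [0..<m]) :: 'n pf"
  have "pf_shift (x * y) * ?P = pf_shift x * (pf_shift y * ?P)"
    by (simp only: pf_shift_simps mult.assoc)
  also have "\<dots> = (pf_shift x * ?P) * y"
    by (simp only: mult.IH(2) mult.assoc)
  finally show ?case by (simp only: mult.IH(1) mult.assoc)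
qed

theorem mainTheorem7:
  fixes \<zeta> s :: complex
    and b_minus b_plus :: "nat \<Rightarrow> 'n::finite pf"
  assumes "CARD('n) \<ge> 2"
    and "\<zeta>\<^sup>2 = pf_q CARD('n)"
    and "\<zeta> ^ (CARD('n)\<^sup>2) = 1"
    and "s\<^sup>2 = pf_omega CARD('n) \<zeta>"
  defines "b_minus \<equiv> pf_b_minus s"
    and "b_plus \<equiv> pf_b_plus s"
  shows "b_plus 0 \<in> PF_graded 2 0 \<and> b_minus 0 \<in> PF_graded 2 0 \<and>
    pf_SFT \<zeta> 2 (b_plus 0) = b_minus 0 \<and>
    pf_SFT \<zeta> 2 (b_minus 0) = b_plus 0 \<and>
    b_plus 0 * b_minus 0 = 1 \<and>
    (\<forall>m\<ge>1. \<forall>x\<in>PF m.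
      pf_shift x * prod_list (map b_plus [0..<m]) = prod_list (map b_plus [0..<m]) * x)"
proof -
  have root: "gauss_root CARD('n) \<zeta>"
    using assms(2,3) by unfold_locales simp_all
  have s: "s \<noteq> 0"
    using root assms(4) by (rule gauss_root.gauss_inv_eq)
  have "b_plus 0 \<in> PF_graded 2 0" "b_minus 0 \<in> PF_graded 2 0"
    unfolding b_minus_def b_plus_def pf_b_plus_neutral pf_b_minus_neutral
    by (rule pf_neutral_graded)+
  then show ?thesis
    unfolding b_minus_def b_plus_def
    using pf_SFT_b_plus [OF root assms(4)] pf_SFT_b_minus [OF root assms(4)]
      pf_b_plus_mult_b_minus [OF s] pf_box_slide_string
    by blast
qed

end
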